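(* Let $E:\mathcal{A}\mathrm{ff}_{\mathcal{C}}\to \mathcal{A}\mathrm{ff}_{\mathcal{C},E}$ be an energy functor (as defined in the context). Then $E$ preserves homotopy fiber products: for all maps $X\to Z$ and $Y\to Z$ in $\mathcal{A}\mathrm{ff}_{\mathcal{C}}$, $$E\big(X\times^h_Z Y\big)\;\cong\; EX\times^h_{EZ}EY .$$
   Context: Setting: $\mathcal{C}$ is a symmetric monoidal model category, with simplicial objects, satisfying the conditions of a homotopical algebraic context in the sense of Toën–Vezzosi (HAG II). $\mathrm{Comm}(\mathcal{C})$ is the model category of commutative monoids in $\mathcal{C}$, $\mathcal{A}\mathrm{ff}_{\mathcal{C}}=\mathrm{Comm}(\mathcal{C})^{\mathrm{op}}$, and $\tau$ is a model topology on $\mathcal{A}\mathrm{ff}_{\mathcal{C}}$, i.e. a Grothendieck topology on $\mathrm{Ho}(\mathcal{A}\mathrm{ff}_{\mathcal{C}})$. Energy functor: An energy is a symmetric monoidal functor $E:\mathcal{C}\to\mathcal{C}_E$, where $\mathcal{C}_E=E(\mathcal{C})$ is again a symmetric monoidal model category, an (enriched) copy, or replica, of $\mathcal{C}$; its objects are written $EX$. It induces functors, still written $E$, $\mathrm{Comm}(\mathcal{C})\to\mathrm{Comm}(\mathcal{C}_E)$ and $\mathcal{A}\mathrm{ff}_{\mathcal{C}}\to\mathcal{A}\mathrm{ff}_{\mathcal{C},E}=\mathrm{Comm}(\mathcal{C}_E)^{\mathrm{op}}$. The following is required. (1) $\mathcal{A}\mathrm{ff}_{\mathcal{C},E}$ is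 a replica of $\mathcal{A}\mathrm{ff}_{\mathcal{C}}$: $E$ preserves equivalences and small limits, in particular pullbacks, and isomorphisms $EX\to EY$ in $\mathrm{Ho}(\mathcal{A}\mathrm{ff}_{\mathcal{C},E})$ come from isomorphisms $X\to Y$ in $\mathrm{Ho}(\mathcal{A}\mathrm{ff}_{\mathcal{C}})$. (2) $E$ preserves and reflects covers: $\mathcal{A}\mathrm{ff}_{\mathcal{C},E}$ carries the topology $\tau_E=E(\tau)$, in which $\{EX_i\to EX\}$ is a covering in $\mathrm{Ho}(\mathcal{A}\mathrm{ff}_{\mathcal{C},E})$ if and only if $\{X_i\to X\}$ is a covering in $\mathrm{Ho}(\mathcal{A}\mathrm{ff}_{\mathcal{C}})$. (3) $E$ preserves functorial factorizations: if $X\to\mathcal{E}(X)\to Y$ is the fixed functorial factorization of a map $X\to Y$ in $\mathcal{A}\mathrm{ff}_{\mathcal{C}}$, and $EX\to\mathcal{E}_E(EX)\to EY$ is the fixed functorial factorization of $EX\to EY$ in $\mathcal{A}\mathrm{ff}_{\mathcal{C},E}$, then $\mathcal{E}_E(EX)=E(\mathcal{E}(X))$, and the image under $E$ of the first factorization is the second one. (4) $E$ is $\mathrm{Set}_\Delta$-equivariant: for every simplicial object $A_*$ and simplicial set $K$, $E(\underline{K}\otimes A_* )\cong\underline{K}\otimes EA_*$, where $\underline{K}\otimes A_*$ is the simplicial object $[n]\mapsto\coprod_{K_n}A_n$ and $E$ is applied levelwise. Homotopy fiber products: the functorial factorization on $\mathcal{A}\mathrm{ff}_{\mathcal{C}}$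 is fixed in such a way that, for maps $X\to Z$ and $Y\to Z$, with factorizations $X\to\mathcal{E}(X)\to Z$ and $Y\to\mathcal{E}(Y)\to Z$, one has $X\times^h_Z Y=\mathcal{E}(X)\times_Z\mathcal{E}(Y)$. Likewise in $\mathcal{A}\mathrm{ff}_{\mathcal{C},E}$, $EX\times^h_{EZ}EY=\mathcal{E}_E(EX)\times_{EZ}\mathcal{E}_E(EY)$. *)

theory Defs
  imports Main
begin

unbundle cardinal_syntax

text \<open>
  Sizes. HAG II works relative to a universe; here the universe is the cardinal of a type
  \<open>'u\<close>, and ``small'' means of cardinality less than that of \<open>'u\<close>. The type is passed around as
  \<open>TYPE('u)\<close>. Index categories of small (co)limits have their objects and arrows in \<open>'u\<close>,
  which is no restriction up to isomorphism.
\<close>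

definition universe :: "'u itself \<Rightarrow> bool" where
  "universe U \<longleftrightarrow>
     natLeq <o |UNIV :: 'u set| \<and> regularCard |UNIV :: 'u set| \<and>
     (\<forall>A :: 'u set. |A| <o |UNIV :: 'u set| \<longrightarrow> |Pow A| <o |UNIV :: 'u set| )"

definition small :: "'u itself \<Rightarrow> 'a set \<Rightarrow> bool" where
  "small U S \<longleftrightarrow> |S| <o |UNIV :: 'u set|"


section \<open>Categories, functors, limits\<close>

record ('o, 'm) cat =
  Ob :: "'o set"
  Mor :: "'m set"
  Dom :: "'m \<Rightarrow> 'o"
  Cod :: "'m \<Rightarrow> 'o"
  Id :: "'o \<Rightarrow> 'm"
  Comp :: "'m \<Rightarrow> 'm \<Rightarrow> 'm"  (infixr \<open>\<cdot>\<index>\<close> 70)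

definition hom :: "('o, 'm) cat \<Rightarrow> 'o \<Rightarrow> 'o \<Rightarrow> 'm set" where
  "hom C X Y = {f \<in> Mor C. Dom C f = X \<and> Cod C f = Y}"

definition category :: "('o, 'm) cat \<Rightarrow> bool" where
  "category C \<longleftrightarrow>
     (\<forall>f \<in> Mor C. Dom C f \<in> Ob C \<and> Cod C f \<in> Ob C) \<and>
     (\<forall>X \<in> Ob C. Id C X \<in> hom C X X) \<and>
     (\<forall>X Y Z f g. f \<in> hom C X Y \<longrightarrow> g \<in> hom C Y Z \<longrightarrow> g \<cdot>\<^bsub>C\<^esub> f \<in> hom C X Z) \<and>
     (\<forall>X Y f. f \<in> hom C X Y \<longrightarrow> f \<cdot>\<^bsub>C\<^esub> Id C X = f \<and> Id C Y \<cdot>\<^bsub>C\<^esub> f = f) \<and>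
     (\<forall>W X Y Z f g h. f \<in> hom C W X \<longrightarrow> g \<in> hom C X Y \<longrightarrow> h \<in> hom C Y Z \<longrightarrow>
        h \<cdot>\<^bsub>C\<^esub> (g \<cdot>\<^bsub>C\<^esub> f) = (h \<cdot>\<^bsub>C\<^esub> g) \<cdot>\<^bsub>C\<^esub> f)"

definition op :: "('o, 'm) cat \<Rightarrow> ('o, 'm) cat" where
  "op C = \<lparr>Ob = Ob C, Mor = Mor C, Dom = Cod C, Cod = Dom C, Id = Id C,
           Comp = (\<lambda>g f. f \<cdot>\<^bsub>C\<^esub> g)\<rparr>"

definition iso :: "('o, 'm) cat \<Rightarrow> 'o \<Rightarrow> 'o \<Rightarrow> 'm \<Rightarrow> bool" where
  "iso C X Y f \<longleftrightarrow> f \<in> hom C X Y \<and> (\<exists>g \<in> hom C Y X. g \<cdot>\<^bsub>C\<^esub> f = Id C X \<and> f \<cdot>\<^bsub>C\<^esub> g = Id C Y)"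

definition isomorphic :: "('o, 'm) cat \<Rightarrow> 'o \<Rightarrow> 'o \<Rightarrow> bool" where
  "isomorphic C X Y \<longleftrightarrow> X \<in> Ob C \<and> Y \<in> Ob C \<and> (\<exists>f. iso C X Y f)"

record ('o, 'm, 'p, 'n) ftr =
  FO :: "'o \<Rightarrow> 'p"
  FM :: "'m \<Rightarrow> 'n"

definition is_functor ::
  "('o, 'm) cat \<Rightarrow> ('p, 'n) cat \<Rightarrow> ('o, 'm, 'p, 'n, 'z) ftr_scheme \<Rightarrow> bool" where
  "is_functor C D F \<longleftrightarrow>
     (\<forall>X \<in> Ob C. FO F X \<in> Ob D \<and> FM F (Id C X) = Id D (FO F X)) \<and>
     (\<forall>X Y f. f \<in> hom C X Y \<longrightarrow> FM F f \<in> hom D (FO F X) (FO F Y)) \<and>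
     (\<forall>X Y Z f g. f \<in> hom C X Y \<longrightarrow> g \<in> hom C Y Z \<longrightarrow>
        FM F (g \<cdot>\<^bsub>C\<^esub> f) = FM F g \<cdot>\<^bsub>D\<^esub> FM F f)"

definition ftr_comp ::
  "('p, 'n, 'q, 'r, 'y) ftr_scheme \<Rightarrow> ('o, 'm, 'p, 'n, 'z) ftr_scheme \<Rightarrow> ('o, 'm, 'q, 'r) ftr"
  where "ftr_comp G F = \<lparr>FO = FO G \<circ> FO F, FM = FM G \<circ> FM F\<rparr>"

definition naturally_isomorphic ::
  "('o, 'm) cat \<Rightarrow> ('p, 'n) cat \<Rightarrow> ('o, 'm, 'p, 'n) ftr \<Rightarrow> ('o, 'm, 'p, 'n) ftr \<Rightarrow> bool" where
  "naturally_isomorphic C D F G \<longleftrightarrow>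
     (\<exists>\<eta>. (\<forall>X \<in> Ob C. iso D (FO F X) (FO G X) (\<eta> X)) \<and>
          (\<forall>X Y f. f \<in> hom C X Y \<longrightarrow> FM G f \<cdot>\<^bsub>D\<^esub> \<eta> X = \<eta> Y \<cdot>\<^bsub>D\<^esub> FM F f))"

definition is_cone ::
  "('i, 'j) cat \<Rightarrow> ('o, 'm) cat \<Rightarrow> ('i, 'j, 'o, 'm) ftr \<Rightarrow> 'o \<Rightarrow> ('i \<Rightarrow> 'm) \<Rightarrow> bool" where
  "is_cone J C D L p \<longleftrightarrow>
     L \<in> Ob C \<and> (\<forall>i \<in> Ob J. p i \<in> hom C L (FO D i)) \<and>
     (\<forall>i j a. a \<in> hom J i j \<longrightarrow> FM D a \<cdot>\<^bsub>C\<^esub> p i = p j)"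

definition is_limit ::
  "('i, 'j) cat \<Rightarrow> ('o, 'm) cat \<Rightarrow> ('i, 'j, 'o, 'm) ftr \<Rightarrow> 'o \<Rightarrow> ('i \<Rightarrow> 'm) \<Rightarrow> bool" where
  "is_limit J C D L p \<longleftrightarrow>
     is_cone J C D L p \<and>
     (\<forall>X q. is_cone J C D X q \<longrightarrow>
        (\<exists>!h. h \<in> hom C X L \<and> (\<forall>i \<in> Ob J. p i \<cdot>\<^bsub>C\<^esub> h = q i)))"

definition is_colimit ::
  "('i, 'j) cat \<Rightarrow> ('o, 'm) cat \<Rightarrow> ('i, 'j, 'o, 'm) ftr \<Rightarrow> 'o \<Rightarrow> ('i \<Rightarrow> 'm) \<Rightarrow> bool" where
  "is_colimit J C D L p \<longleftrightarrow> is_limit (op J) (op C) D L p"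

definition small_diagram ::
  "'u itself \<Rightarrow> ('u, 'u) cat \<Rightarrow> ('o, 'm) cat \<Rightarrow> ('u, 'u, 'o, 'm) ftr \<Rightarrow> bool" where
  "small_diagram U J C D \<longleftrightarrow>
     category J \<and> small U (Ob J) \<and> small U (Mor J) \<and> is_functor J C D"

definition complete :: "'u itself \<Rightarrow> ('o, 'm) cat \<Rightarrow> bool" where
  "complete U C \<longleftrightarrow>
     (\<forall>J (D :: ('u, 'u, 'o, 'm) ftr). small_diagram U J C D \<longrightarrow> (\<exists>L p. is_limit J C D L p))"

definition cocomplete :: "'u itself \<Rightarrow> ('o, 'm) cat \<Rightarrow> bool" where
  "cocomplete U C \<longleftrightarrow>
     (\<forall>J (D :: ('u, 'u, 'o, 'm) ftr). small_diagram U J C D \<longrightarrow> (\<exists>L p. is_colimit J C D L p))"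

definition preserves_small_limits ::
  "'u itself \<Rightarrow> ('o, 'm) cat \<Rightarrow> ('p, 'n) cat \<Rightarrow> ('o, 'm, 'p, 'n) ftr \<Rightarrow> bool" where
  "preserves_small_limits U C D F \<longleftrightarrow>
     (\<forall>J (X :: ('u, 'u, 'o, 'm) ftr) L p. small_diagram U J C X \<longrightarrow> is_limit J C X L p \<longrightarrow>
        is_limit J D (ftr_comp F X) (FO F L) (FM F \<circ> p))"

definition terminal :: "('o, 'm) cat \<Rightarrow> 'o \<Rightarrow> bool" where
  "terminal C X \<longleftrightarrow> X \<in> Ob C \<and> (\<forall>Y \<in> Ob C. \<exists>!f. f \<in> hom C Y X)"

definition initial :: "('o, 'm) cat \<Rightarrow> 'o \<Rightarrow> bool" where
  "initial C X \<longleftrightarrow> terminal (op C) X"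

definition is_product ::
  "('o, 'm) cat \<Rightarrow> 'i set \<Rightarrow> ('i \<Rightarrow> 'o) \<Rightarrow> 'o \<Rightarrow> ('i \<Rightarrow> 'm) \<Rightarrow> bool" where
  "is_product C I X P p \<longleftrightarrow>
     P \<in> Ob C \<and> (\<forall>i \<in> I. p i \<in> hom C P (X i)) \<and>
     (\<forall>Q q. Q \<in> Ob C \<longrightarrow> (\<forall>i \<in> I. q i \<in> hom C Q (X i)) \<longrightarrow>
        (\<exists>!h. h \<in> hom C Q P \<and> (\<forall>i \<in> I. p i \<cdot>\<^bsub>C\<^esub> h = q i)))"

definition is_coproduct ::
  "('o, 'm) cat \<Rightarrow> 'i set \<Rightarrow> ('i \<Rightarrow> 'o) \<Rightarrow> 'o \<Rightarrow> ('i \<Rightarrow> 'm) \<Rightarrow> bool" where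
  "is_coproduct C I X P p \<longleftrightarrow> is_product (op C) I X P p"

definition is_pullback ::
  "('o, 'm) cat \<Rightarrow> 'm \<Rightarrow> 'm \<Rightarrow> 'o \<Rightarrow> 'm \<Rightarrow> 'm \<Rightarrow> bool" where
  "is_pullback C f g P p q \<longleftrightarrow>
     f \<in> Mor C \<and> g \<in> Mor C \<and> Cod C f = Cod C g \<and>
     p \<in> hom C P (Dom C f) \<and> q \<in> hom C P (Dom C g) \<and> f \<cdot>\<^bsub>C\<^esub> p = g \<cdot>\<^bsub>C\<^esub> q \<and>
     (\<forall>Q a b. a \<in> hom C Q (Dom C f) \<longrightarrow> b \<in> hom C Q (Dom C g) \<longrightarrow> f \<cdot>\<^bsub>C\<^esub> a = g \<cdot>\<^bsub>C\<^esub> b \<longrightarrow>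
        (\<exists>!h. h \<in> hom C Q P \<and> p \<cdot>\<^bsub>C\<^esub> h = a \<and> q \<cdot>\<^bsub>C\<^esub> h = b))"

definition is_pushout ::
  "('o, 'm) cat \<Rightarrow> 'm \<Rightarrow> 'm \<Rightarrow> 'o \<Rightarrow> 'm \<Rightarrow> 'm \<Rightarrow> bool" where
  "is_pushout C f g P p q \<longleftrightarrow> is_pullback (op C) f g P p q"

definition is_coequalizer :: "('o, 'm) cat \<Rightarrow> 'm \<Rightarrow> 'm \<Rightarrow> 'o \<Rightarrow> 'm \<Rightarrow> bool" where
  "is_coequalizer C f g P t \<longleftrightarrow>
     t \<in> hom C (Cod C f) P \<and> t \<cdot>\<^bsub>C\<^esub> f = t \<cdot>\<^bsub>C\<^esub> g \<and>
     (\<forall>Q s. s \<in> hom C (Cod C f) Q \<longrightarrow> s \<cdot>\<^bsub>C\<^esub> f = s \<cdot>\<^bsub>C\<^esub> g \<longrightarrow>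
        (\<exists>!h. h \<in> hom C P Q \<and> h \<cdot>\<^bsub>C\<^esub> t = s))"

definition zero_object :: "('o, 'm) cat \<Rightarrow> 'o \<Rightarrow> bool" where
  "zero_object C Z \<longleftrightarrow> initial C Z \<and> terminal C Z"

definition zero_map :: "('o, 'm) cat \<Rightarrow> 'm \<Rightarrow> bool" where
  "zero_map C f \<longleftrightarrow>
     (\<exists>X Y Z a b. zero_object C Z \<and> a \<in> hom C X Z \<and> b \<in> hom C Z Y \<and> f = b \<cdot>\<^bsub>C\<^esub> a)"

definition additive_category :: "('o, 'm) cat \<Rightarrow> bool" where
  "additive_category C \<longleftrightarrow>
     category C \<and> (\<exists>Z. zero_object C Z) \<and>
     (\<forall>X :: bool \<Rightarrow> 'o. range X \<subseteq> Ob C \<longrightarrow>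
        (\<exists>P p. is_product C UNIV X P p) \<and> (\<exists>P p. is_coproduct C UNIV X P p)) \<and>
     (\<exists>add :: 'm \<Rightarrow> 'm \<Rightarrow> 'm.
        (\<forall>X \<in> Ob C. \<forall>Y \<in> Ob C.
           (\<forall>f \<in> hom C X Y. \<forall>g \<in> hom C X Y. add f g \<in> hom C X Y \<and> add f g = add g f) \<and>
           (\<forall>f \<in> hom C X Y. \<forall>g \<in> hom C X Y. \<forall>h \<in> hom C X Y.
              add (add f g) h = add f (add g h)) \<and>
           (\<exists>z \<in> hom C X Y. (\<forall>f \<in> hom C X Y. add z f = f) \<and>
              (\<forall>f \<in> hom C X Y. \<exists>g \<in> hom C X Y. add f g = z))) \<and>
        (\<forall>X Y Z. \<forall>f \<in> hom C X Y. \<forall>f' \<in> hom C X Y. \<forall>g \<in> hom C Y Z. \<forall>g' \<in> hom C Y Z.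
           g \<cdot>\<^bsub>C\<^esub> add f f' = add (g \<cdot>\<^bsub>C\<^esub> f) (g \<cdot>\<^bsub>C\<^esub> f') \<and>
           add g g' \<cdot>\<^bsub>C\<^esub> f = add (g \<cdot>\<^bsub>C\<^esub> f) (g' \<cdot>\<^bsub>C\<^esub> f)))"


section \<open>Locally presentable categories\<close>

text \<open>Directed index preorders are regarded as thin categories; \<open>l\<close> is the regular cardinal.\<close>

definition directed_index :: "'u itself \<Rightarrow> 'u rel \<Rightarrow> ('u, 'u) cat \<Rightarrow> bool" where
  "directed_index U l J \<longleftrightarrow>
     category J \<and> small U (Ob J) \<and> small U (Mor J) \<and>
     (\<forall>i j a b. a \<in> hom J i j \<longrightarrow> b \<in> hom J i j \<longrightarrow> a = b) \<and>
     (\<forall>S \<subseteq> Ob J. |S| <o l \<longrightarrow> (\<exists>j \<in> Ob J. \<forall>i \<in> S. hom J i j \<noteq> {}))"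

text \<open>\<open>hom(X, -)\<close> preserves \<open>l\<close>-directed colimits, spelled out for the hom sets.\<close>

definition presentable :: "'u itself \<Rightarrow> 'u rel \<Rightarrow> ('o, 'm) cat \<Rightarrow> 'o \<Rightarrow> bool" where
  "presentable U l C X \<longleftrightarrow>
     X \<in> Ob C \<and>
     (\<forall>J (D :: ('u, 'u, 'o, 'm) ftr) L p.
        directed_index U l J \<longrightarrow> is_functor J C D \<longrightarrow> is_colimit J C D L p \<longrightarrow>
        (\<forall>f \<in> hom C X L. \<exists>i \<in> Ob J. \<exists>g \<in> hom C X (FO D i). f = p i \<cdot>\<^bsub>C\<^esub> g) \<and>
        (\<forall>i \<in> Ob J. \<forall>g \<in> hom C X (FO D i). \<forall>g' \<in> hom C X (FO D i).
           p i \<cdot>\<^bsub>C\<^esub> g = p i \<cdot>\<^bsub>C\<^esub> g' \<longrightarrow>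
           (\<exists>j a. a \<in> hom J i j \<and> FM D a \<cdot>\<^bsub>C\<^esub> g = FM D a \<cdot>\<^bsub>C\<^esub> g')))"

definition locally_presentable :: "'u itself \<Rightarrow> ('o, 'm) cat \<Rightarrow> bool" where
  "locally_presentable U C \<longleftrightarrow>
     category C \<and> cocomplete U C \<and> (\<forall>X \<in> Ob C. \<forall>Y \<in> Ob C. small U (hom C X Y)) \<and>
     (\<exists>l :: 'u rel. Card_order l \<and> cinfinite l \<and> regularCard l \<and> l <o |UNIV :: 'u set| \<and>
        (\<exists>G. small U G \<and> (\<forall>X \<in> G. presentable U l C X) \<and>
           (\<forall>X \<in> Ob C. \<exists>J (D :: ('u, 'u, 'o, 'm) ftr) p.
              directed_index U l J \<and> is_functor J C D \<and> FO D ` Ob J \<subseteq> G \<and>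
              is_colimit J C D X p)))"


section \<open>Model categories\<close>

record 'm model =
  WE :: "'m set"
  Cof :: "'m set"
  Fib :: "'m set"

definition op_model :: "'m model \<Rightarrow> 'm model" where
  "op_model M = \<lparr>WE = WE M, Cof = Fib M, Fib = Cof M\<rparr>"

definition lifts :: "('o, 'm) cat \<Rightarrow> 'm \<Rightarrow> 'm \<Rightarrow> bool" where
  "lifts C i p \<longleftrightarrow>
     (\<forall>u v. u \<in> hom C (Dom C i) (Dom C p) \<longrightarrow> v \<in> hom C (Cod C i) (Cod C p) \<longrightarrow>
        p \<cdot>\<^bsub>C\<^esub> u = v \<cdot>\<^bsub>C\<^esub> i \<longrightarrow>
        (\<exists>h \<in> hom C (Cod C i) (Dom C p). h \<cdot>\<^bsub>C\<^esub> i = u \<and> p \<cdot>\<^bsub>C\<^esub> h = v))"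

definition is_retract :: "('o, 'm) cat \<Rightarrow> 'm \<Rightarrow> 'm \<Rightarrow> bool" where
  "is_retract C f g \<longleftrightarrow>
     f \<in> Mor C \<and> g \<in> Mor C \<and>
     (\<exists>a b c d. a \<in> hom C (Dom C f) (Dom C g) \<and> b \<in> hom C (Dom C g) (Dom C f) \<and>
        c \<in> hom C (Cod C f) (Cod C g) \<and> d \<in> hom C (Cod C g) (Cod C f) \<and>
        b \<cdot>\<^bsub>C\<^esub> a = Id C (Dom C f) \<and> d \<cdot>\<^bsub>C\<^esub> c = Id C (Cod C f) \<and>
        g \<cdot>\<^bsub>C\<^esub> a = c \<cdot>\<^bsub>C\<^esub> f \<and> f \<cdot>\<^bsub>C\<^esub> b = d \<cdot>\<^bsub>C\<^esub> g)"

text \<open>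
  A functorial factorization: \<open>f = rgt f \<cdot> lft f\<close> through \<open>mid f\<close>, with \<open>mid_map f g u v\<close> the
  map \<open>mid f \<rightarrow> mid g\<close> induced by a commutative square \<open>v \<cdot> f = g \<cdot> u\<close>.
\<close>

record ('o, 'm) factorization =
  mid :: "'m \<Rightarrow> 'o"
  lft :: "'m \<Rightarrow> 'm"
  rgt :: "'m \<Rightarrow> 'm"
  mid_map :: "'m \<Rightarrow> 'm \<Rightarrow> 'm \<Rightarrow> 'm \<Rightarrow> 'm"

definition is_square :: "('o, 'm) cat \<Rightarrow> 'm \<Rightarrow> 'm \<Rightarrow> 'm \<Rightarrow> 'm \<Rightarrow> bool" where
  "is_square C f g u v \<longleftrightarrow>
     f \<in> Mor C \<and> g \<in> Mor C \<and> u \<in> hom C (Dom C f) (Dom C g) \<and> v \<in> hom C (Cod C f) (Cod C g) \<and>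
     v \<cdot>\<^bsub>C\<^esub> f = g \<cdot>\<^bsub>C\<^esub> u"

definition functorial_factorization ::
  "('o, 'm) cat \<Rightarrow> 'm set \<Rightarrow> 'm set \<Rightarrow> ('o, 'm) factorization \<Rightarrow> bool" where
  "functorial_factorization C L R F \<longleftrightarrow>
     (\<forall>X Y f. f \<in> hom C X Y \<longrightarrow>
        mid F f \<in> Ob C \<and> lft F f \<in> hom C X (mid F f) \<and> rgt F f \<in> hom C (mid F f) Y \<and>
        lft F f \<in> L \<and> rgt F f \<in> R \<and> rgt F f \<cdot>\<^bsub>C\<^esub> lft F f = f \<and>
        mid_map F f f (Id C X) (Id C Y) = Id C (mid F f)) \<and>
     (\<forall>f g u v. is_square C f g u v \<longrightarrow>
        mid_map F f g u v \<in> hom C (mid F f) (mid F g) \<and>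
        mid_map F f g u v \<cdot>\<^bsub>C\<^esub> lft F f = lft F g \<cdot>\<^bsub>C\<^esub> u \<and>
        rgt F g \<cdot>\<^bsub>C\<^esub> mid_map F f g u v = v \<cdot>\<^bsub>C\<^esub> rgt F f) \<and>
     (\<forall>f g h u v u' v'. is_square C f g u v \<longrightarrow> is_square C g h u' v' \<longrightarrow>
        mid_map F f h (u' \<cdot>\<^bsub>C\<^esub> u) (v' \<cdot>\<^bsub>C\<^esub> v) = mid_map F g h u' v' \<cdot>\<^bsub>C\<^esub> mid_map F f g u v)"

definition wide_subcategory :: "('o, 'm) cat \<Rightarrow> 'm set \<Rightarrow> bool" where
  "wide_subcategory C S \<longleftrightarrow>
     S \<subseteq> Mor C \<and> (\<forall>X \<in> Ob C. Id C X \<in> S) \<and>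
     (\<forall>f \<in> S. \<forall>g \<in> S. Cod C f = Dom C g \<longrightarrow> g \<cdot>\<^bsub>C\<^esub> f \<in> S)"

definition model_category :: "'u itself \<Rightarrow> ('o, 'm) cat \<Rightarrow> 'm model \<Rightarrow> bool" where
  "model_category U C M \<longleftrightarrow>
     category C \<and> complete U C \<and> cocomplete U C \<and>
     wide_subcategory C (WE M) \<and> wide_subcategory C (Cof M) \<and> wide_subcategory C (Fib M) \<and>
     (\<forall>X Y Z f g. f \<in> hom C X Y \<longrightarrow> g \<in> hom C Y Z \<longrightarrow>
        (g \<in> WE M \<and> g \<cdot>\<^bsub>C\<^esub> f \<in> WE M \<longrightarrow> f \<in> WE M) \<and>
        (f \<in> WE M \<and> g \<cdot>\<^bsub>C\<^esub> f \<in> WE M \<longrightarrow> g \<in> WE M)) \<and>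
     (\<forall>f g. is_retract C f g \<longrightarrow>
        (g \<in> WE M \<longrightarrow> f \<in> WE M) \<and> (g \<in> Cof M \<longrightarrow> f \<in> Cof M) \<and> (g \<in> Fib M \<longrightarrow> f \<in> Fib M)) \<and>
     (\<forall>i \<in> Cof M. \<forall>p \<in> Fib M. i \<in> WE M \<or> p \<in> WE M \<longrightarrow> lifts C i p) \<and>
     (\<exists>F. functorial_factorization C (Cof M) (WE M \<inter> Fib M) F) \<and>
     (\<exists>F. functorial_factorization C (WE M \<inter> Cof M) (Fib M) F)"

definition cofibrant :: "('o, 'm) cat \<Rightarrow> 'm model \<Rightarrow> 'o \<Rightarrow> bool" where
  "cofibrant C M X \<longleftrightarrow> (\<exists>I i. initial C I \<and> i \<in> hom C I X \<and> i \<in> Cof M)"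

definition cofibrant_replacement :: "('o, 'm) cat \<Rightarrow> 'm model \<Rightarrow> 'o \<Rightarrow> 'o \<Rightarrow> 'm \<Rightarrow> bool" where
  "cofibrant_replacement C M X Q q \<longleftrightarrow>
     cofibrant C M Q \<and> q \<in> hom C Q X \<and> q \<in> WE M \<and> q \<in> Fib M"

definition fibrant_replacement :: "('o, 'm) cat \<Rightarrow> 'm model \<Rightarrow> 'o \<Rightarrow> 'o \<Rightarrow> 'm \<Rightarrow> bool" where
  "fibrant_replacement C M X R r \<longleftrightarrow> cofibrant_replacement (op C) (op_model M) X R r"

definition right_proper :: "('o, 'm) cat \<Rightarrow> 'm model \<Rightarrow> bool" where
  "right_proper C M \<longleftrightarrow>
     (\<forall>f g P p q. is_pullback C f g P p q \<longrightarrow> f \<in> WE M \<longrightarrow> g \<in> Fib M \<longrightarrow> q \<in> WE M)"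

definition proper :: "('o, 'm) cat \<Rightarrow> 'm model \<Rightarrow> bool" where
  "proper C M \<longleftrightarrow> right_proper C M \<and> right_proper (op C) (op_model M)"

text \<open>
  In a locally presentable category every object is presentable for some cardinal, so the
  smallness conditions on the domains of the generating maps hold automatically.
\<close>

definition combinatorial_model_category :: "'u itself \<Rightarrow> ('o, 'm) cat \<Rightarrow> 'm model \<Rightarrow> bool" where
  "combinatorial_model_category U C M \<longleftrightarrow>
     model_category U C M \<and> locally_presentable U C \<and>
     (\<exists>I J. small U I \<and> small U J \<and> I \<subseteq> Mor C \<and> J \<subseteq> Mor C \<and>
        Fib M = {p \<in> Mor C. \<forall>j \<in> J. lifts C j p} \<and>
        WE M \<inter> Fib M = {p \<in> Mor C. \<forall>i \<in> I. lifts C i p})"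


section \<open>Homotopy category\<close>

text \<open>
  \<open>Ho C W\<close> is the localization of \<open>C\<close> at \<open>W\<close>: paths of arrows of \<open>C\<close> and formal inverses of
  arrows in \<open>W\<close>, modulo the evident relations. Paths are written in diagrammatic order.
\<close>

datatype 'm zigzag = Fwd 'm | Bwd 'm

fun is_path :: "('o, 'm) cat \<Rightarrow> 'm set \<Rightarrow> 'o \<Rightarrow> 'm zigzag list \<Rightarrow> 'o \<Rightarrow> bool" where
  "is_path C W X [] Y \<longleftrightarrow> X \<in> Ob C \<and> X = Y"
| "is_path C W X (Fwd f # s) Y \<longleftrightarrow> f \<in> Mor C \<and> Dom C f = X \<and> is_path C W (Cod C f) s Y"
| "is_path C W X (Bwd w # s) Y \<longleftrightarrow> w \<in> W \<and> Cod C w = X \<and> is_path C W (Dom C w) s Y"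

inductive path_eq ::
  "('o, 'm) cat \<Rightarrow> 'm set \<Rightarrow> 'o \<Rightarrow> 'm zigzag list \<Rightarrow> 'm zigzag list \<Rightarrow> 'o \<Rightarrow> bool"
  for C W where
  refl: "is_path C W X s Y \<Longrightarrow> path_eq C W X s s Y"
| sym: "path_eq C W X s t Y \<Longrightarrow> path_eq C W X t s Y"
| trans: "path_eq C W X s t Y \<Longrightarrow> path_eq C W X t u Y \<Longrightarrow> path_eq C W X s u Y"
| cong: "is_path C W X a X' \<Longrightarrow> path_eq C W X' s t Y' \<Longrightarrow> is_path C W Y' b Y \<Longrightarrow>
    path_eq C W X (a @ s @ b) (a @ t @ b) Y"
| ident: "X \<in> Ob C \<Longrightarrow> path_eq C W X [Fwd (Id C X)] [] X"
| comp: "f \<in> hom C X Y \<Longrightarrow> g \<in> hom C Y Z \<Longrightarrow> path_eq C W X [Fwd f, Fwd g] [Fwd (g \<cdot>\<^bsub>C\<^esub> f)] Z"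
| inv_right: "w \<in> W \<Longrightarrow> w \<in> hom C X Y \<Longrightarrow> path_eq C W X [Fwd w, Bwd w] [] X"
| inv_left: "w \<in> W \<Longrightarrow> w \<in> hom C X Y \<Longrightarrow> path_eq C W Y [Bwd w, Fwd w] [] Y"

type_synonym ('o, 'm) ho_mor = "'o \<times> 'm zigzag list set \<times> 'o"

definition path_class ::
  "('o, 'm) cat \<Rightarrow> 'm set \<Rightarrow> 'o \<Rightarrow> 'm zigzag list \<Rightarrow> 'o \<Rightarrow> ('o, 'm) ho_mor" where
  "path_class C W X s Y = (X, {t. path_eq C W X s t Y}, Y)"

definition Ho :: "('o, 'm) cat \<Rightarrow> 'm set \<Rightarrow> ('o, ('o, 'm) ho_mor) cat" where
  "Ho C W =
     \<lparr>Ob = Ob C,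
      Mor = {path_class C W X s Y | X s Y. is_path C W X s Y},
      Dom = (\<lambda>(X, S, Y). X),
      Cod = (\<lambda>(X, S, Y). Y),
      Id = (\<lambda>X. path_class C W X [] X),
      Comp = (\<lambda>(Y', T, Z) (X, S, Y). (X, {u. \<exists>s \<in> S. \<exists>t \<in> T. path_eq C W X (s @ t) u Z}, Z))\<rparr>"

definition to_Ho :: "('o, 'm) cat \<Rightarrow> 'm set \<Rightarrow> 'm \<Rightarrow> ('o, 'm) ho_mor" where
  "to_Ho C W f = path_class C W (Dom C f) [Fwd f] (Cod C f)"

text \<open>The functor induced on localizations at \<open>V\<close> and \<open>W\<close> by an \<open>F : C \<rightarrow> D\<close> with \<open>F(V) \<subseteq> W\<close>;
  the domain and its weak equivalences enter only through the classes of paths.\<close>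

definition Ho_map ::
  "('p, 'n) cat \<Rightarrow> 'n set \<Rightarrow> ('o, 'm, 'p, 'n) ftr \<Rightarrow> ('o, 'm) ho_mor \<Rightarrow> ('p, 'n) ho_mor" where
  "Ho_map D W F = (\<lambda>(X, S, Y).
     (FO F X, {t. \<exists>s \<in> S. path_eq D W (FO F X) (map (map_zigzag (FM F)) s) t (FO F Y)}, FO F Y))"


section \<open>Homotopy fiber products and model topologies\<close>

text \<open>
  \<open>X \<times>\<^sup>h\<^sub>Z Y\<close> for \<open>f : X \<rightarrow> Z\<close> and \<open>g : Y \<rightarrow> Z\<close>, where \<open>F\<close> is the fixed functorial factorization
  (a trivial cofibration followed by a fibration): the pullback of \<open>\<E>(X) \<rightarrow> Z \<leftarrow> \<E>(Y)\<close>.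
\<close>

definition homotopy_fiber_product ::
  "('o, 'm) cat \<Rightarrow> ('o, 'm) factorization \<Rightarrow> 'm \<Rightarrow> 'm \<Rightarrow> 'o" where
  "homotopy_fiber_product C F f g = (SOME P. \<exists>p q. is_pullback C (rgt F f) (rgt F g) P p q)"

text \<open>
  In \<open>Ho C W\<close>: \<open>w\<close> is the homotopy base change of \<open>u : U \<rightarrow> X\<close> along \<open>v : V \<rightarrow> X\<close>. The cospan
  \<open>u, v\<close> is represented, up to isomorphism in the homotopy category, by maps \<open>f, g\<close> of \<open>C\<close>,
  and \<open>w\<close> is identified with \<open>P \<rightarrow> \<E>(Dom g) \<leftarrow> Dom g\<close>, \<open>P\<close> being their homotopy fiber product.
\<close>

definition homotopy_base_change ::
  "('o, 'm) cat \<Rightarrow> 'm set \<Rightarrow> ('o, 'm) factorization \<Rightarrow>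
   ('o, 'm) ho_mor \<Rightarrow> ('o, 'm) ho_mor \<Rightarrow> ('o, 'm) ho_mor \<Rightarrow> bool" where
  "homotopy_base_change C W F u v w \<longleftrightarrow>
     (let H = Ho C W; \<gamma> = to_Ho C W in
      u \<in> Mor H \<and> v \<in> Mor H \<and> w \<in> Mor H \<and> Cod H u = Cod H v \<and> Cod H w = Dom H v \<and>
      (\<exists>f g P p q a b c d.
         f \<in> Mor C \<and> g \<in> Mor C \<and> Cod C f = Cod C g \<and>
         is_pullback C (rgt F f) (rgt F g) P p q \<and>
         iso H (Dom H u) (Dom C f) a \<and> iso H (Dom H v) (Dom C g) b \<and>
         iso H (Cod H u) (Cod C f) c \<and> iso H (Dom H w) P d \<and>
         c \<cdot>\<^bsub>H\<^esub> u = \<gamma> f \<cdot>\<^bsub>H\<^esub> a \<and> c \<cdot>\<^bsub>H\<^esub> v = \<gamma> g \<cdot>\<^bsub>H\<^esub> b \<and>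
         \<gamma> q \<cdot>\<^bsub>H\<^esub> d = \<gamma> (lft F g) \<cdot>\<^bsub>H\<^esub> (b \<cdot>\<^bsub>H\<^esub> w)))"

text \<open>\<open>Cov X\<close> is the set of covering families of \<open>X\<close>, a family being a set of maps to \<open>X\<close> in
  the homotopy category.\<close>

definition model_topology ::
  "('o, 'm) cat \<Rightarrow> 'm set \<Rightarrow> ('o, 'm) factorization \<Rightarrow>
   ('o \<Rightarrow> ('o, 'm) ho_mor set set) \<Rightarrow> bool" where
  "model_topology C W F Cov \<longleftrightarrow>
     (let H = Ho C W in
      (\<forall>X \<in> Ob C. \<forall>S \<in> Cov X. S \<subseteq> {u \<in> Mor H. Cod H u = X}) \<and>
      (\<forall>X Y u. iso H Y X u \<longrightarrow> {u} \<in> Cov X) \<and>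
      (\<forall>X \<in> Ob C. \<forall>S \<in> Cov X. \<forall>R. (\<forall>u \<in> S. R u \<in> Cov (Dom H u)) \<longrightarrow>
         {u \<cdot>\<^bsub>H\<^esub> v | u v. u \<in> S \<and> v \<in> R u} \<in> Cov X) \<and>
      (\<forall>X \<in> Ob C. \<forall>S \<in> Cov X. \<forall>Y v B. v \<in> hom H Y X \<longrightarrow>
         (\<forall>u \<in> S. homotopy_base_change C W F u v (B u)) \<longrightarrow> B ` S \<in> Cov Y))"


section \<open>Symmetric monoidal categories\<close>

text \<open>
  Components of the structure: \<open>asc X Y Z : (X \<otimes> Y) \<otimes> Z \<rightarrow> X \<otimes> (Y \<otimes> Z)\<close>, \<open>lun X : 1 \<otimes> X \<rightarrow> X\<close>,
  \<open>run X : X \<otimes> 1 \<rightarrow> X\<close>, \<open>swp X Y : X \<otimes> Y \<rightarrow> Y \<otimes> X\<close>.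
\<close>

record ('o, 'm) tensor =
  tO :: "'o \<Rightarrow> 'o \<Rightarrow> 'o"  (infixr \<open>\<otimes>\<index>\<close> 75)
  tM :: "'m \<Rightarrow> 'm \<Rightarrow> 'm"  (infixr \<open>\<odot>\<index>\<close> 75)
  one :: 'o
  asc :: "'o \<Rightarrow> 'o \<Rightarrow> 'o \<Rightarrow> 'm"
  lun :: "'o \<Rightarrow> 'm"
  run :: "'o \<Rightarrow> 'm"
  swp :: "'o \<Rightarrow> 'o \<Rightarrow> 'm"

definition symmetric_monoidal :: "('o, 'm) cat \<Rightarrow> ('o, 'm) tensor \<Rightarrow> bool" where
  "symmetric_monoidal C T \<longleftrightarrow>
     category C \<and> one T \<in> Ob C \<and>
     (\<forall>X \<in> Ob C. \<forall>Y \<in> Ob C. X \<otimes>\<^bsub>T\<^esub> Y \<in> Ob C \<and> Id C X \<odot>\<^bsub>T\<^esub> Id C Y = Id C (X \<otimes>\<^bsub>T\<^esub> Y)) \<and>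
     (\<forall>X X' Y Y' f g. f \<in> hom C X X' \<longrightarrow> g \<in> hom C Y Y' \<longrightarrow>
        f \<odot>\<^bsub>T\<^esub> g \<in> hom C (X \<otimes>\<^bsub>T\<^esub> Y) (X' \<otimes>\<^bsub>T\<^esub> Y')) \<and>
     (\<forall>X X' X'' Y Y' Y'' f f' g g'. f \<in> hom C X X' \<longrightarrow> f' \<in> hom C X' X'' \<longrightarrow>
        g \<in> hom C Y Y' \<longrightarrow> g' \<in> hom C Y' Y'' \<longrightarrow>
        (f' \<cdot>\<^bsub>C\<^esub> f) \<odot>\<^bsub>T\<^esub> (g' \<cdot>\<^bsub>C\<^esub> g) = (f' \<odot>\<^bsub>T\<^esub> g') \<cdot>\<^bsub>C\<^esub> (f \<odot>\<^bsub>T\<^esub> g)) \<and>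
     (\<forall>X \<in> Ob C. \<forall>Y \<in> Ob C. \<forall>Z \<in> Ob C.
        iso C ((X \<otimes>\<^bsub>T\<^esub> Y) \<otimes>\<^bsub>T\<^esub> Z) (X \<otimes>\<^bsub>T\<^esub> (Y \<otimes>\<^bsub>T\<^esub> Z)) (asc T X Y Z)) \<and>
     (\<forall>X \<in> Ob C. iso C (one T \<otimes>\<^bsub>T\<^esub> X) X (lun T X) \<and> iso C (X \<otimes>\<^bsub>T\<^esub> one T) X (run T X)) \<and>
     (\<forall>X \<in> Ob C. \<forall>Y \<in> Ob C. swp T X Y \<in> hom C (X \<otimes>\<^bsub>T\<^esub> Y) (Y \<otimes>\<^bsub>T\<^esub> X) \<and>
        swp T Y X \<cdot>\<^bsub>C\<^esub> swp T X Y = Id C (X \<otimes>\<^bsub>T\<^esub> Y)) \<and>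
     (\<forall>X X' Y Y' Z Z' f g h. f \<in> hom C X X' \<longrightarrow> g \<in> hom C Y Y' \<longrightarrow> h \<in> hom C Z Z' \<longrightarrow>
        asc T X' Y' Z' \<cdot>\<^bsub>C\<^esub> ((f \<odot>\<^bsub>T\<^esub> g) \<odot>\<^bsub>T\<^esub> h) = (f \<odot>\<^bsub>T\<^esub> (g \<odot>\<^bsub>T\<^esub> h)) \<cdot>\<^bsub>C\<^esub> asc T X Y Z) \<and>
     (\<forall>X X' f. f \<in> hom C X X' \<longrightarrow>
        lun T X' \<cdot>\<^bsub>C\<^esub> (Id C (one T) \<odot>\<^bsub>T\<^esub> f) = f \<cdot>\<^bsub>C\<^esub> lun T X \<and>
        run T X' \<cdot>\<^bsub>C\<^esub> (f \<odot>\<^bsub>T\<^esub> Id C (one T)) = f \<cdot>\<^bsub>C\<^esub> run T X) \<and>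
     (\<forall>X X' Y Y' f g. f \<in> hom C X X' \<longrightarrow> g \<in> hom C Y Y' \<longrightarrow>
        swp T X' Y' \<cdot>\<^bsub>C\<^esub> (f \<odot>\<^bsub>T\<^esub> g) = (g \<odot>\<^bsub>T\<^esub> f) \<cdot>\<^bsub>C\<^esub> swp T X Y) \<and>
     (\<forall>W \<in> Ob C. \<forall>X \<in> Ob C. \<forall>Y \<in> Ob C. \<forall>Z \<in> Ob C.
        asc T W X (Y \<otimes>\<^bsub>T\<^esub> Z) \<cdot>\<^bsub>C\<^esub> asc T (W \<otimes>\<^bsub>T\<^esub> X) Y Z =
        (Id C W \<odot>\<^bsub>T\<^esub> asc T X Y Z) \<cdot>\<^bsub>C\<^esub> (asc T W (X \<otimes>\<^bsub>T\<^esub> Y) Z \<cdot>\<^bsub>C\<^esub> (asc T W X Y \<odot>\<^bsub>T\<^esub> Id C Z))) \<and>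
     (\<forall>X \<in> Ob C. \<forall>Y \<in> Ob C.
        (Id C X \<odot>\<^bsub>T\<^esub> lun T Y) \<cdot>\<^bsub>C\<^esub> asc T X (one T) Y = run T X \<odot>\<^bsub>T\<^esub> Id C Y) \<and>
     (\<forall>X \<in> Ob C. \<forall>Y \<in> Ob C. \<forall>Z \<in> Ob C.
        asc T Y Z X \<cdot>\<^bsub>C\<^esub> (swp T X (Y \<otimes>\<^bsub>T\<^esub> Z) \<cdot>\<^bsub>C\<^esub> asc T X Y Z) =
        (Id C Y \<odot>\<^bsub>T\<^esub> swp T X Z) \<cdot>\<^bsub>C\<^esub> (asc T Y X Z \<cdot>\<^bsub>C\<^esub> (swp T X Y \<odot>\<^bsub>T\<^esub> Id C Z)))"

definition closed :: "('o, 'm) cat \<Rightarrow> ('o, 'm) tensor \<Rightarrow> bool" where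
  "closed C T \<longleftrightarrow>
     (\<forall>X \<in> Ob C. \<forall>Y \<in> Ob C. \<exists>H \<in> Ob C. \<exists>ev \<in> hom C (H \<otimes>\<^bsub>T\<^esub> X) Y.
        \<forall>Z \<in> Ob C. \<forall>f \<in> hom C (Z \<otimes>\<^bsub>T\<^esub> X) Y. \<exists>!h. h \<in> hom C Z H \<and> ev \<cdot>\<^bsub>C\<^esub> (h \<odot>\<^bsub>T\<^esub> Id C X) = f)"

text \<open>Hovey's definition: closed symmetric monoidal, with the pushout-product axiom and the unit
  axiom (one-sided, by symmetry).\<close>

definition symmetric_monoidal_model_category ::
  "'u itself \<Rightarrow> ('o, 'm) cat \<Rightarrow> ('o, 'm) tensor \<Rightarrow> 'm model \<Rightarrow> bool" where
  "symmetric_monoidal_model_category U C T M \<longleftrightarrow>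
     model_category U C M \<and> symmetric_monoidal C T \<and> closed C T \<and>
     (\<forall>A B K L f g P i j h.
        f \<in> hom C A B \<longrightarrow> g \<in> hom C K L \<longrightarrow> f \<in> Cof M \<longrightarrow> g \<in> Cof M \<longrightarrow>
        is_pushout C (f \<odot>\<^bsub>T\<^esub> Id C K) (Id C A \<odot>\<^bsub>T\<^esub> g) P i j \<longrightarrow>
        h \<in> hom C P (B \<otimes>\<^bsub>T\<^esub> L) \<longrightarrow>
        h \<cdot>\<^bsub>C\<^esub> i = Id C B \<odot>\<^bsub>T\<^esub> g \<longrightarrow> h \<cdot>\<^bsub>C\<^esub> j = f \<odot>\<^bsub>T\<^esub> Id C L \<longrightarrow>
        h \<in> Cof M \<and> (f \<in> WE M \<or> g \<in> WE M \<longrightarrow> h \<in> WE M)) \<and>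
     (\<forall>Q q X. cofibrant_replacement C M (one T) Q q \<longrightarrow> cofibrant C M X \<longrightarrow>
        lun T X \<cdot>\<^bsub>C\<^esub> (q \<odot>\<^bsub>T\<^esub> Id C X) \<in> WE M)"


section \<open>Commutative monoids, modules, algebras\<close>

text \<open>
  The category of objects of \<open>C\<close> with extra structure: \<open>S\<close> is the set of structured objects,
  \<open>V\<close> takes underlying objects and \<open>H A B f\<close> says that \<open>f\<close> respects the structures. Arrows
  carry their structured source and target.
\<close>

type_synonym ('a, 'm) struct_mor = "'a \<times> 'm \<times> 'a"

definition underlying :: "('a, 'm) struct_mor \<Rightarrow> 'm" where
  "underlying F = fst (snd F)"

definition struct_cat ::
  "('o, 'm) cat \<Rightarrow> 'a set \<Rightarrow> ('a \<Rightarrow> 'o) \<Rightarrow> ('a \<Rightarrow> 'a \<Rightarrow> 'm \<Rightarrow> bool) \<Rightarrow>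
   ('a, ('a, 'm) struct_mor) cat" where
  "struct_cat C S V H =
     \<lparr>Ob = S,
      Mor = {(A, f, B) | A f B. A \<in> S \<and> B \<in> S \<and> f \<in> hom C (V A) (V B) \<and> H A B f},
      Dom = (\<lambda>(A, f, B). A),
      Cod = (\<lambda>(A, f, B). B),
      Id = (\<lambda>A. (A, Id C (V A), A)),
      Comp = (\<lambda>(B', g, D) (A, f, B). (A, g \<cdot>\<^bsub>C\<^esub> f, D))\<rparr>"

text \<open>Equivalences and fibrations are those of the underlying maps, cofibrations are determined
  by the lifting property.\<close>

definition lifted_model ::
  "('a, ('a, 'm) struct_mor) cat \<Rightarrow> 'm model \<Rightarrow> ('a, 'm) struct_mor model" where
  "lifted_model D M =
     \<lparr>WE = {F \<in> Mor D. underlying F \<in> WE M},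
      Cof = {F \<in> Mor D. \<forall>G \<in> Mor D. underlying G \<in> WE M \<inter> Fib M \<longrightarrow> lifts D F G},
      Fib = {F \<in> Mor D. underlying F \<in> Fib M}\<rparr>"

text \<open>A commutative monoid is a triple \<open>(X, \<mu> : X \<otimes> X \<rightarrow> X, \<eta> : 1 \<rightarrow> X)\<close>.\<close>

type_synonym ('o, 'm) monoid_obj = "'o \<times> 'm \<times> 'm"

definition comm_semigroup_object :: "('o, 'm) cat \<Rightarrow> ('o, 'm) tensor \<Rightarrow> 'o \<Rightarrow> 'm \<Rightarrow> bool" where
  "comm_semigroup_object C T X \<mu> \<longleftrightarrow>
     X \<in> Ob C \<and> \<mu> \<in> hom C (X \<otimes>\<^bsub>T\<^esub> X) X \<and>
     \<mu> \<cdot>\<^bsub>C\<^esub> (\<mu> \<odot>\<^bsub>T\<^esub> Id C X) = \<mu> \<cdot>\<^bsub>C\<^esub> ((Id C X \<odot>\<^bsub>T\<^esub> \<mu>) \<cdot>\<^bsub>C\<^esub> asc T X X X) \<and>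
     \<mu> \<cdot>\<^bsub>C\<^esub> swp T X X = \<mu>"

definition comm_monoid_object ::
  "('o, 'm) cat \<Rightarrow> ('o, 'm) tensor \<Rightarrow> ('o, 'm) monoid_obj \<Rightarrow> bool" where
  "comm_monoid_object C T = (\<lambda>(X, \<mu>, \<eta>).
     comm_semigroup_object C T X \<mu> \<and> \<eta> \<in> hom C (one T) X \<and>
     \<mu> \<cdot>\<^bsub>C\<^esub> (\<eta> \<odot>\<^bsub>T\<^esub> Id C X) = lun T X \<and> \<mu> \<cdot>\<^bsub>C\<^esub> (Id C X \<odot>\<^bsub>T\<^esub> \<eta>) = run T X)"

definition Comm ::
  "('o, 'm) cat \<Rightarrow> ('o, 'm) tensor \<Rightarrow>
   (('o, 'm) monoid_obj, (('o, 'm) monoid_obj, 'm) struct_mor) cat" where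
  "Comm C T = struct_cat C {A. comm_monoid_object C T A} fst
     (\<lambda>(X, \<mu>, \<eta>) (X', \<mu>', \<eta>') f. f \<cdot>\<^bsub>C\<^esub> \<mu> = \<mu>' \<cdot>\<^bsub>C\<^esub> (f \<odot>\<^bsub>T\<^esub> f) \<and> f \<cdot>\<^bsub>C\<^esub> \<eta> = \<eta>')"

text \<open>Non-unital commutative monoids.\<close>

definition Comm_nu ::
  "('o, 'm) cat \<Rightarrow> ('o, 'm) tensor \<Rightarrow> ('o \<times> 'm, ('o \<times> 'm, 'm) struct_mor) cat" where
  "Comm_nu C T = struct_cat C {(X, \<mu>). comm_semigroup_object C T X \<mu>} fst
     (\<lambda>(X, \<mu>) (X', \<mu>') f. f \<cdot>\<^bsub>C\<^esub> \<mu> = \<mu>' \<cdot>\<^bsub>C\<^esub> (f \<odot>\<^bsub>T\<^esub> f))"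

text \<open>A module over \<open>A\<close> is a pair \<open>(N, a : A \<otimes> N \<rightarrow> N)\<close>.\<close>

type_synonym ('o, 'm) module_obj = "'o \<times> 'm"
type_synonym ('o, 'm) module_mor = "(('o, 'm) module_obj, 'm) struct_mor"

definition module_object ::
  "('o, 'm) cat \<Rightarrow> ('o, 'm) tensor \<Rightarrow> ('o, 'm) monoid_obj \<Rightarrow> ('o, 'm) module_obj \<Rightarrow> bool" where
  "module_object C T = (\<lambda>(A, \<mu>, \<eta>) (N, a).
     N \<in> Ob C \<and> a \<in> hom C (A \<otimes>\<^bsub>T\<^esub> N) N \<and>
     a \<cdot>\<^bsub>C\<^esub> (\<mu> \<odot>\<^bsub>T\<^esub> Id C N) = a \<cdot>\<^bsub>C\<^esub> ((Id C A \<odot>\<^bsub>T\<^esub> a) \<cdot>\<^bsub>C\<^esub> asc T A A N) \<and>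
     a \<cdot>\<^bsub>C\<^esub> (\<eta> \<odot>\<^bsub>T\<^esub> Id C N) = lun T N)"

definition Mod ::
  "('o, 'm) cat \<Rightarrow> ('o, 'm) tensor \<Rightarrow> ('o, 'm) monoid_obj \<Rightarrow>
   (('o, 'm) module_obj, ('o, 'm) module_mor) cat" where
  "Mod C T A = struct_cat C {N. module_object C T A N} fst
     (\<lambda>(N, a) (N', a') f. f \<cdot>\<^bsub>C\<^esub> a = a' \<cdot>\<^bsub>C\<^esub> (Id C (fst A) \<odot>\<^bsub>T\<^esub> f))"

text \<open>
  \<open>t : M \<otimes> N \<rightarrow> P\<close> exhibits \<open>P\<close> as \<open>M \<otimes>\<^sub>A N\<close>: it is the coequalizer of the two actions
  \<open>(M \<otimes> A) \<otimes> N \<rightarrow> M \<otimes> N\<close>, and the action on \<open>P\<close> is induced by the one on \<open>M\<close>.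
\<close>

definition is_tensor_over ::
  "('o, 'm) cat \<Rightarrow> ('o, 'm) tensor \<Rightarrow> ('o, 'm) monoid_obj \<Rightarrow>
   ('o, 'm) module_obj \<Rightarrow> ('o, 'm) module_obj \<Rightarrow> ('o, 'm) module_obj \<Rightarrow> 'm \<Rightarrow> bool" where
  "is_tensor_over C T A = (\<lambda>(M, a) (N, b) (P, c) t.
     module_object C T A (P, c) \<and>
     is_coequalizer C ((a \<cdot>\<^bsub>C\<^esub> swp T M (fst A)) \<odot>\<^bsub>T\<^esub> Id C N)
       ((Id C M \<odot>\<^bsub>T\<^esub> b) \<cdot>\<^bsub>C\<^esub> asc T M (fst A) N) P t \<and>
     c \<cdot>\<^bsub>C\<^esub> ((Id C (fst A) \<odot>\<^bsub>T\<^esub> t) \<cdot>\<^bsub>C\<^esub> asc T (fst A) M N) = t \<cdot>\<^bsub>C\<^esub> (a \<odot>\<^bsub>T\<^esub> Id C N))"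

definition tensor_over ::
  "('o, 'm) cat \<Rightarrow> ('o, 'm) tensor \<Rightarrow> ('o, 'm) monoid_obj \<Rightarrow>
   ('o, 'm) module_obj \<Rightarrow> ('o, 'm) module_obj \<Rightarrow> ('o, 'm) module_obj \<times> 'm" where
  "tensor_over C T A M N = (SOME (P, t). is_tensor_over C T A M N P t)"

text \<open>The symmetric monoidal structure of \<open>A\<close>-modules; all structure maps are induced by those
  of \<open>C\<close> through the universal maps \<open>t M N : M \<otimes> N \<rightarrow> M \<otimes>\<^sub>A N\<close>.\<close>

definition Mod_tensor ::
  "('o, 'm) cat \<Rightarrow> ('o, 'm) tensor \<Rightarrow> ('o, 'm) monoid_obj \<Rightarrow>
   (('o, 'm) module_obj, ('o, 'm) module_mor) tensor" where
  "Mod_tensor C T A =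
     (let D = Mod C T A;
          X = (\<lambda>M N. fst (tensor_over C T A M N));
          t = (\<lambda>M N. snd (tensor_over C T A M N));
          I = (fst A, fst (snd A))
      in
      \<lparr>tO = X,
       tM = (\<lambda>f g. THE h. h \<in> hom D (X (Dom D f) (Dom D g)) (X (Cod D f) (Cod D g)) \<and>
               underlying h \<cdot>\<^bsub>C\<^esub> t (Dom D f) (Dom D g) =
               t (Cod D f) (Cod D g) \<cdot>\<^bsub>C\<^esub> (underlying f \<odot>\<^bsub>T\<^esub> underlying g)),
       one = I,
       asc = (\<lambda>M N P. THE h. h \<in> hom D (X (X M N) P) (X M (X N P)) \<and>
               underlying h \<cdot>\<^bsub>C\<^esub> (t (X M N) P \<cdot>\<^bsub>C\<^esub> (t M N \<odot>\<^bsub>T\<^esub> Id C (fst P))) =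
               t M (X N P) \<cdot>\<^bsub>C\<^esub> ((Id C (fst M) \<odot>\<^bsub>T\<^esub> t N P) \<cdot>\<^bsub>C\<^esub> asc T (fst M) (fst N) (fst P))),
       lun = (\<lambda>M. THE h. h \<in> hom D (X I M) M \<and> underlying h \<cdot>\<^bsub>C\<^esub> t I M = snd M),
       run = (\<lambda>M. THE h. h \<in> hom D (X M I) M \<and>
               underlying h \<cdot>\<^bsub>C\<^esub> t M I = snd M \<cdot>\<^bsub>C\<^esub> swp T (fst M) (fst A)),
       swp = (\<lambda>M N. THE h. h \<in> hom D (X M N) (X N M) \<and>
               underlying h \<cdot>\<^bsub>C\<^esub> t M N = t N M \<cdot>\<^bsub>C\<^esub> swp T (fst M) (fst N))\<rparr>)"


section \<open>Homotopical algebraic contexts\<close>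

text \<open>
  For all \<open>X, Y\<close> the natural maps \<open>QX \<squnion> QY \<rightarrow> X \<squnion> Y \<rightarrow> RX \<times> RY\<close> are equivalences. The index
  type \<open>bool\<close> labels the two summands; the second map has matrix \<open>diag(r\<^sub>X, r\<^sub>Y)\<close> with zero maps
  off the diagonal.
\<close>

definition sums_are_products :: "('o, 'm) cat \<Rightarrow> 'm model \<Rightarrow> bool" where
  "sums_are_products C M \<longleftrightarrow>
     (\<forall>(X :: bool \<Rightarrow> 'o) S \<iota>. is_coproduct C UNIV X S \<iota> \<longrightarrow>
        (\<forall>Q q S' \<iota>' h. (\<forall>i. cofibrant_replacement C M (X i) (Q i) (q i)) \<longrightarrow>
           is_coproduct C UNIV Q S' \<iota>' \<longrightarrow> h \<in> hom C S' S \<longrightarrow>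
           (\<forall>i. h \<cdot>\<^bsub>C\<^esub> \<iota>' i = \<iota> i \<cdot>\<^bsub>C\<^esub> q i) \<longrightarrow> h \<in> WE M) \<and>
        (\<forall>R r P \<pi> h. (\<forall>i. fibrant_replacement C M (X i) (R i) (r i)) \<longrightarrow>
           is_product C UNIV R P \<pi> \<longrightarrow> h \<in> hom C S P \<longrightarrow>
           (\<forall>i j. if i = j then \<pi> j \<cdot>\<^bsub>C\<^esub> (h \<cdot>\<^bsub>C\<^esub> \<iota> i) = r i
                  else zero_map C (\<pi> j \<cdot>\<^bsub>C\<^esub> (h \<cdot>\<^bsub>C\<^esub> \<iota> i))) \<longrightarrow> h \<in> WE M))"

text \<open>
  The conditions on \<open>C\<close> in Toen--Vezzosi's definition of a homotopical algebraic context
  \<open>(C, C\<^sub>0, \<A>)\<close> (HAG II, Assumptions 1.1.0.1--1.1.0.4). The auxiliary subcategories \<open>C\<^sub>0\<close> and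
  \<open>\<A>\<close> impose nothing further on \<open>C\<close>: one may take \<open>C\<^sub>0 = C\<close> and \<open>\<A>\<close> empty.
\<close>

definition HA_context ::
  "'u itself \<Rightarrow> ('o, 'm) cat \<Rightarrow> ('o, 'm) tensor \<Rightarrow> 'm model \<Rightarrow> bool" where
  "HA_context U C T M \<longleftrightarrow>
     symmetric_monoidal_model_category U C T M \<and>
     proper C M \<and> (\<exists>Z. zero_object C Z) \<and> sums_are_products C M \<and>
     additive_category (Ho C (WE M)) \<and>
     (\<forall>A \<in> Ob (Comm C T).
        let D = Mod C T A; TD = Mod_tensor C T A; MD = lifted_model D M;
            D' = Comm D TD; MD' = lifted_model D' MD;
            D'' = Comm_nu D TD; MD'' = lifted_model D'' MD
        in
        combinatorial_model_category U D MD \<and> proper D MD \<and>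
        symmetric_monoidal_model_category U D TD MD \<and>
        (\<forall>N. cofibrant D MD N \<longrightarrow> (\<forall>f \<in> WE MD. f \<odot>\<^bsub>TD\<^esub> Id D N \<in> WE MD)) \<and>
        combinatorial_model_category U D' MD' \<and> proper D' MD' \<and>
        (\<forall>B. cofibrant D' MD' B \<longrightarrow> (\<forall>f \<in> WE MD. Id D (fst B) \<odot>\<^bsub>TD\<^esub> f \<in> WE MD)) \<and>
        combinatorial_model_category U D'' MD'' \<and> proper D'' MD'')"

type_synonym ('o, 'm) aff_obj = "('o, 'm) monoid_obj"
type_synonym ('o, 'm) aff_mor = "(('o, 'm) monoid_obj, 'm) struct_mor"

definition Aff ::
  "('o, 'm) cat \<Rightarrow> ('o, 'm) tensor \<Rightarrow> (('o, 'm) aff_obj, ('o, 'm) aff_mor) cat" where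
  "Aff C T = op (Comm C T)"

definition Aff_model ::
  "('o, 'm) cat \<Rightarrow> ('o, 'm) tensor \<Rightarrow> 'm model \<Rightarrow> ('o, 'm) aff_mor model" where
  "Aff_model C T M = op_model (lifted_model (Comm C T) M)"


section \<open>Symmetric monoidal functors\<close>

text \<open>\<open>\<phi> X Y : EX \<otimes> EY \<rightarrow> E(X \<otimes> Y)\<close> and \<open>\<phi>0 : 1 \<rightarrow> E1\<close> are isomorphisms (strong functors).\<close>

record ('o, 'm, 'p, 'n) mon_ftr = "('o, 'm, 'p, 'n) ftr" +
  \<phi> :: "'o \<Rightarrow> 'o \<Rightarrow> 'n"
  \<phi>0 :: 'n

definition symmetric_monoidal_functor ::
  "('o, 'm) cat \<Rightarrow> ('o, 'm) tensor \<Rightarrow> ('p, 'n) cat \<Rightarrow> ('p, 'n) tensor \<Rightarrow>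
   ('o, 'm, 'p, 'n) mon_ftr \<Rightarrow> bool" where
  "symmetric_monoidal_functor C T D S E \<longleftrightarrow>
     is_functor C D E \<and>
     iso D (one S) (FO E (one T)) (\<phi>0 E) \<and>
     (\<forall>X \<in> Ob C. \<forall>Y \<in> Ob C.
        iso D (FO E X \<otimes>\<^bsub>S\<^esub> FO E Y) (FO E (X \<otimes>\<^bsub>T\<^esub> Y)) (\<phi> E X Y)) \<and>
     (\<forall>X X' Y Y' f g. f \<in> hom C X X' \<longrightarrow> g \<in> hom C Y Y' \<longrightarrow>
        \<phi> E X' Y' \<cdot>\<^bsub>D\<^esub> (FM E f \<odot>\<^bsub>S\<^esub> FM E g) = FM E (f \<odot>\<^bsub>T\<^esub> g) \<cdot>\<^bsub>D\<^esub> \<phi> E X Y) \<and>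
     (\<forall>X \<in> Ob C. \<forall>Y \<in> Ob C. \<forall>Z \<in> Ob C.
        FM E (asc T X Y Z) \<cdot>\<^bsub>D\<^esub> (\<phi> E (X \<otimes>\<^bsub>T\<^esub> Y) Z \<cdot>\<^bsub>D\<^esub> (\<phi> E X Y \<odot>\<^bsub>S\<^esub> Id D (FO E Z))) =
        \<phi> E X (Y \<otimes>\<^bsub>T\<^esub> Z) \<cdot>\<^bsub>D\<^esub>
          ((Id D (FO E X) \<odot>\<^bsub>S\<^esub> \<phi> E Y Z) \<cdot>\<^bsub>D\<^esub> asc S (FO E X) (FO E Y) (FO E Z))) \<and>
     (\<forall>X \<in> Ob C.
        FM E (lun T X) \<cdot>\<^bsub>D\<^esub> (\<phi> E (one T) X \<cdot>\<^bsub>D\<^esub> (\<phi>0 E \<odot>\<^bsub>S\<^esub> Id D (FO E X))) = lun S (FO E X) \<and>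
        FM E (run T X) \<cdot>\<^bsub>D\<^esub> (\<phi> E X (one T) \<cdot>\<^bsub>D\<^esub> (Id D (FO E X) \<odot>\<^bsub>S\<^esub> \<phi>0 E)) = run S (FO E X)) \<and>
     (\<forall>X \<in> Ob C. \<forall>Y \<in> Ob C.
        FM E (swp T X Y) \<cdot>\<^bsub>D\<^esub> \<phi> E X Y = \<phi> E Y X \<cdot>\<^bsub>D\<^esub> swp S (FO E X) (FO E Y))"

text \<open>The functor induced on commutative monoids. As data on objects and arrows it is also the
  functor between the opposite categories.\<close>

definition Aff_functor ::
  "('p, 'n) cat \<Rightarrow> ('o, 'm, 'p, 'n) mon_ftr \<Rightarrow>
   (('o, 'm) aff_obj, ('o, 'm) aff_mor, ('p, 'n) aff_obj, ('p, 'n) aff_mor) ftr" where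
  "Aff_functor D E =
     (let E' = (\<lambda>(X, \<mu>, \<eta>). (FO E X, FM E \<mu> \<cdot>\<^bsub>D\<^esub> \<phi> E X X, FM E \<eta> \<cdot>\<^bsub>D\<^esub> \<phi>0 E))
      in \<lparr>FO = E', FM = (\<lambda>(A, f, B). (E' A, FM E f, E' B))\<rparr>)"


section \<open>Simplicial objects\<close>

text \<open>The simplex category: \<open>(n, xs) : [length xs - 1] \<rightarrow> [n]\<close> is the monotone map with list of
  values \<open>xs\<close>.\<close>

definition simplex_cat :: "(nat, nat \<times> nat list) cat" where
  "simplex_cat =
     \<lparr>Ob = UNIV,
      Mor = {(n, xs). xs \<noteq> [] \<and> sorted xs \<and> (\<forall>x \<in> set xs. x \<le> n)},
      Dom = (\<lambda>(n, xs). length xs - 1),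
      Cod = fst,
      Id = (\<lambda>n. (n, [0..<Suc n])),
      Comp = (\<lambda>(p, ys) (n, xs). (p, map (\<lambda>x. ys ! x) xs))\<rparr>"

type_synonym ('o, 'm) simplicial = "(nat, nat \<times> nat list, 'o, 'm) ftr"

definition simplicial_object :: "('o, 'm) cat \<Rightarrow> ('o, 'm) simplicial \<Rightarrow> bool" where
  "simplicial_object C A \<longleftrightarrow> is_functor (op simplex_cat) C A"

record 'u sset =
  simplices :: "nat \<Rightarrow> 'u set"
  act :: "nat \<times> nat list \<Rightarrow> 'u \<Rightarrow> 'u"

definition simplicial_set :: "'u itself \<Rightarrow> 'u sset \<Rightarrow> bool" where
  "simplicial_set U K \<longleftrightarrow>
     (\<forall>n. small U (simplices K n)) \<and>
     (\<forall>m n a. a \<in> hom simplex_cat m n \<longrightarrow> act K a ` simplices K n \<subseteq> simplices K m) \<and>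
     (\<forall>n. \<forall>x \<in> simplices K n. act K (Id simplex_cat n) x = x) \<and>
     (\<forall>l m n a b. a \<in> hom simplex_cat l m \<longrightarrow> b \<in> hom simplex_cat m n \<longrightarrow>
        (\<forall>x \<in> simplices K n. act K (b \<cdot>\<^bsub>simplex_cat\<^esub> a) x = act K a (act K b x)))"

text \<open>\<open>B\<close> is \<open>K \<otimes> A\<close>: in degree \<open>n\<close> the coproduct of copies of \<open>A\<^sub>n\<close> indexed by \<open>K\<^sub>n\<close>, with
  coprojections \<open>\<iota> n x\<close>.\<close>

definition is_simplicial_tensor ::
  "('o, 'm) cat \<Rightarrow> 'u sset \<Rightarrow> ('o, 'm) simplicial \<Rightarrow> ('o, 'm) simplicial \<Rightarrow> bool" where
  "is_simplicial_tensor C K A B \<longleftrightarrow>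
     simplicial_object C B \<and>
     (\<exists>\<iota>. (\<forall>n. is_coproduct C (simplices K n) (\<lambda>_. FO A n) (FO B n) (\<iota> n)) \<and>
          (\<forall>m n a. a \<in> hom simplex_cat m n \<longrightarrow> (\<forall>x \<in> simplices K n.
             FM B a \<cdot>\<^bsub>C\<^esub> \<iota> n x = \<iota> m (act K a x) \<cdot>\<^bsub>C\<^esub> FM A a)))"


section \<open>Energy functors\<close>

text \<open>
  \<open>(C, T, M)\<close> is the symmetric monoidal model category, \<open>Cov\<close> the topology on \<open>Aff C\<close> and \<open>F\<close>
  the fixed functorial factorization of \<open>Aff C\<close>; \<open>(D, S, N)\<close>, \<open>Cov'\<close>, \<open>F'\<close> are the same data
  for the replica \<open>D = C\<^sub>E\<close>.
\<close>

definition energy_functor ::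
  "'u itself \<Rightarrow>
   ('o, 'm) cat \<Rightarrow> ('o, 'm) tensor \<Rightarrow> 'm model \<Rightarrow>
   (('o, 'm) aff_obj \<Rightarrow> (('o, 'm) aff_obj, ('o, 'm) aff_mor) ho_mor set set) \<Rightarrow>
   (('o, 'm) aff_obj, ('o, 'm) aff_mor) factorization \<Rightarrow>
   ('p, 'n) cat \<Rightarrow> ('p, 'n) tensor \<Rightarrow> 'n model \<Rightarrow>
   (('p, 'n) aff_obj \<Rightarrow> (('p, 'n) aff_obj, ('p, 'n) aff_mor) ho_mor set set) \<Rightarrow>
   (('p, 'n) aff_obj, ('p, 'n) aff_mor) factorization \<Rightarrow>
   ('o, 'm, 'p, 'n) mon_ftr \<Rightarrow> bool" where
  "energy_functor U C T M Cov F D S N Cov' F' E \<longleftrightarrow>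
     (let A = Aff C T; W = WE (Aff_model C T M); H = Ho A W;
          A' = Aff D S; M' = Aff_model D S N; W' = WE M'; H' = Ho A' W';
          G = Aff_functor D E; HoG = Ho_map A' W' G
      in
      \<comment> \<open>\<open>D\<close> is again a symmetric monoidal model category, with objects the \<open>EX\<close>, whose
          commutative monoids form a model category; \<open>F'\<close> is fixed as on \<open>Aff C\<close>\<close>
      symmetric_monoidal_model_category U D S N \<and>
      model_category U (Comm D S) (lifted_model (Comm D S) N) \<and>
      functorial_factorization A' (WE M' \<inter> Cof M') (Fib M') F' \<and>
      symmetric_monoidal_functor C T D S E \<and> Ob D = FO E ` Ob C \<and>
      \<comment> \<open>(1) \<open>Aff D\<close> is a replica of \<open>Aff C\<close>\<close>
      FM G ` W \<subseteq> W' \<and>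
      preserves_small_limits U A A' G \<and>
      (\<forall>X \<in> Ob A. \<forall>Y \<in> Ob A. \<forall>k. iso H' (FO G X) (FO G Y) k \<longrightarrow>
         (\<exists>h. iso H X Y h \<and> HoG h = k)) \<and>
      \<comment> \<open>(2) covers are preserved and reflected\<close>
      model_topology A' W' F' Cov' \<and>
      (\<forall>X \<in> Ob A. \<forall>R \<subseteq> {u \<in> Mor H. Cod H u = X}. HoG ` R \<in> Cov' (FO G X) \<longleftrightarrow> R \<in> Cov X) \<and>
      \<comment> \<open>(3) functorial factorizations are preserved, on the nose\<close>
      (\<forall>f \<in> Mor A. mid F' (FM G f) = FO G (mid F f) \<and>
         lft F' (FM G f) = FM G (lft F f) \<and> rgt F' (FM G f) = FM G (rgt F f)) \<and>
      \<comment> \<open>(4) simplicial equivariance, for simplicial objects of \<open>C\<close>\<close>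
      (\<forall>(K :: 'u sset) X B B'. simplicial_set U K \<longrightarrow> simplicial_object C X \<longrightarrow>
         is_simplicial_tensor C K X B \<longrightarrow> is_simplicial_tensor D K (ftr_comp E X) B' \<longrightarrow>
         naturally_isomorphic (op simplex_cat) D (ftr_comp E B) B'))"

end

theory Submission
  imports Defs
begin

text \<open>
  The homotopy fiber product of \<open>f\<close> and \<open>g\<close> is an ordinary pullback, that of the fibrations
  \<open>rgt F f\<close> and \<open>rgt F g\<close>. An energy functor carries these two fibrations to
  \<open>rgt F\<^sub>E (Ef)\<close> and \<open>rgt F\<^sub>E (Eg)\<close>, because it respects the chosen factorizations strictly, and it
  carries their pullback to a pullback, because it preserves small limits. So the image of the one
  homotopy fiber product and the other homotopy fiber product are pullbacks of the same cospan, and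
  are therefore isomorphic (\<open>is_pullback_unique\<close>).

  Two points need work. First, small limits are indexed by categories on the fixed universe type, so
  the shape of a cospan has to be realized there, and its limits identified with pullbacks
  (\<open>is_limit_diagram_iff\<close>). Secondly, one needs that \<open>E\<close> on affine objects respects sources, targets
  and identities. This is extracted from limit preservation itself: any \<open>f : X \<rightarrow> Z\<close> is the pullback
  of the identity of \<open>Z\<close> along \<open>f\<close>, with legs \<open>1 : X \<rightarrow> X\<close> and \<open>f : X \<rightarrow> Z\<close>, and the images
  of these legs are again the legs of a limit cone.
\<close>

section \<open>Opposite categories\<close>

lemma hom_op [simp]: "hom (op C) X Y = hom C Y X"
  by (auto simp: hom_def op_def)

lemma op_simps [simp]:
  "Ob (op C) = Ob C" "Mor (op C) = Mor C" "Id (op C) = Id C"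
  "Dom (op C) = Cod C" "Cod (op C) = Dom C" "Comp (op C) g f = f \<cdot>\<^bsub>C\<^esub> g" "op (op C) = C"
  by (simp_all add: op_def)

lemma category_op: "category C \<Longrightarrow> category (op C)"
  unfolding category_def by simp

lemma is_functor_op: "is_functor J (op C) D \<longleftrightarrow> is_functor (op J) C D"
  unfolding is_functor_def by auto

lemma completeD: "complete U C \<Longrightarrow> small_diagram U J C D \<Longrightarrow> \<exists>L p. is_limit J C D L p"
  by (simp add: complete_def)

lemma complete_op:
  fixes U :: "'u itself" and C :: "('o, 'm) cat"
  assumes "cocomplete U C"
  shows "complete U (op C)"
  unfolding complete_def
proof (intro allI impI)
  fix J and D :: "('u, 'u, 'o, 'm) ftr"
  assume "small_diagram U J (op C) D"
  then have "small_diagram U (op J) C D"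
    by (simp add: small_diagram_def category_op is_functor_op)
  then obtain L p where "is_colimit (op J) C D L p"
    using assms unfolding cocomplete_def by blast
  then show "\<exists>L p. is_limit J (op C) D L p"
    by (auto simp: is_colimit_def)
qed


section \<open>Categories and pullbacks\<close>

lemma hom_Ob: "category C \<Longrightarrow> f \<in> hom C X Y \<Longrightarrow> X \<in> Ob C \<and> Y \<in> Ob C"
  by (auto simp: category_def hom_def)

lemma Id_hom: "category C \<Longrightarrow> X \<in> Ob C \<Longrightarrow> Id C X \<in> hom C X X"
  by (simp add: category_def)

lemma Comp_hom:
  "category C \<Longrightarrow> f \<in> hom C X Y \<Longrightarrow> g \<in> hom C Y Z \<Longrightarrow> g \<cdot>\<^bsub>C\<^esub> f \<in> hom C X Z"
  unfolding category_def by blast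

lemma Comp_Id:
  "category C \<Longrightarrow> f \<in> hom C X Y \<Longrightarrow> f \<cdot>\<^bsub>C\<^esub> Id C X = f"
  "category C \<Longrightarrow> f \<in> hom C X Y \<Longrightarrow> Id C Y \<cdot>\<^bsub>C\<^esub> f = f"
  unfolding category_def by blast+

lemma Comp_assoc:
  "category C \<Longrightarrow> f \<in> hom C W X \<Longrightarrow> g \<in> hom C X Y \<Longrightarrow> h \<in> hom C Y Z \<Longrightarrow>
     h \<cdot>\<^bsub>C\<^esub> (g \<cdot>\<^bsub>C\<^esub> f) = (h \<cdot>\<^bsub>C\<^esub> g) \<cdot>\<^bsub>C\<^esub> f"
  unfolding category_def by blast

lemma is_pullbackD:
  assumes "is_pullback C f g P p q"
  shows "p \<in> hom C P (Dom C f)" "q \<in> hom C P (Dom C g)" "f \<cdot>\<^bsub>C\<^esub> p = g \<cdot>\<^bsub>C\<^esub> q"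
    and "a \<in> hom C Q (Dom C f) \<Longrightarrow> b \<in> hom C Q (Dom C g) \<Longrightarrow> f \<cdot>\<^bsub>C\<^esub> a = g \<cdot>\<^bsub>C\<^esub> b \<Longrightarrow>
           \<exists>!h. h \<in> hom C Q P \<and> p \<cdot>\<^bsub>C\<^esub> h = a \<and> q \<cdot>\<^bsub>C\<^esub> h = b"
  using assms unfolding is_pullback_def by simp_all

lemma is_pullback_endo_Id:
  assumes C: "category C" and P: "is_pullback C f g P p q"
    and h: "h \<in> hom C P P" "p \<cdot>\<^bsub>C\<^esub> h = p" "q \<cdot>\<^bsub>C\<^esub> h = q"
  shows "h = Id C P"
proof -
  have "Id C P \<in> hom C P P" "p \<cdot>\<^bsub>C\<^esub> Id C P = p" "q \<cdot>\<^bsub>C\<^esub> Id C P = q"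
    using Id_hom[OF C] hom_Ob[OF C h(1)] Comp_Id(1)[OF C] is_pullbackD(1,2)[OF P] by auto
  then show ?thesis
    using is_pullbackD(4)[OF P is_pullbackD(1-3)[OF P]] h by blast
qed

lemma is_pullback_unique:
  assumes C: "category C" and P: "is_pullback C f g P p q" and P': "is_pullback C f g P' p' q'"
  shows "isomorphic C P P'"
proof -
  obtain h where h: "h \<in> hom C P P'" "p' \<cdot>\<^bsub>C\<^esub> h = p" "q' \<cdot>\<^bsub>C\<^esub> h = q"
    using is_pullbackD(4)[OF P' is_pullbackD(1-3)[OF P]] by blast
  obtain k where k: "k \<in> hom C P' P" "p \<cdot>\<^bsub>C\<^esub> k = p'" "q \<cdot>\<^bsub>C\<^esub> k = q'"
    using is_pullbackD(4)[OF P is_pullbackD(1-3)[OF P']] by blast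
  have "k \<cdot>\<^bsub>C\<^esub> h = Id C P"
    using is_pullback_endo_Id[OF C P Comp_hom[OF C h(1) k(1)]] h k
      Comp_assoc[OF C h(1) k(1)] is_pullbackD(1,2)[OF P] by metis
  moreover have "h \<cdot>\<^bsub>C\<^esub> k = Id C P'"
    using is_pullback_endo_Id[OF C P' Comp_hom[OF C k(1) h(1)]] h k
      Comp_assoc[OF C k(1) h(1)] is_pullbackD(1,2)[OF P'] by metis
  ultimately show ?thesis
    using h(1) k(1) hom_Ob[OF C h(1)] unfolding isomorphic_def iso_def by blast
qed

lemma is_pullback_Id:
  assumes C: "category C" and f: "f \<in> hom C X Z"
  shows "is_pullback C f (Id C Z) X (Id C X) f"
proof -
  note X = Id_hom[OF C conjunct1[OF hom_Ob[OF C f]]]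
  note Z = Id_hom[OF C conjunct2[OF hom_Ob[OF C f]]]
  have "\<exists>!h. h \<in> hom C Q X \<and> Id C X \<cdot>\<^bsub>C\<^esub> h = a \<and> f \<cdot>\<^bsub>C\<^esub> h = b"
    if "a \<in> hom C Q X" "b \<in> hom C Q Z" "f \<cdot>\<^bsub>C\<^esub> a = Id C Z \<cdot>\<^bsub>C\<^esub> b" for Q a b
    using that Comp_Id(2)[OF C] by metis
  then show ?thesis
    using f X Z Comp_Id[OF C f] by (auto simp: is_pullback_def hom_def)
qed


section \<open>Pullbacks as small limits\<close>

lemma universe_infinite: "universe (U :: 'u itself) \<Longrightarrow> infinite (UNIV :: 'u set)"
  using infinite_iff_natLeq_ordLeq ordLess_imp_ordLeq unfolding universe_def by blast

lemma finite_small: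
  assumes "infinite (UNIV :: 'u set)" "finite S"
  shows "small (U :: 'u itself) S"
proof -
  have "|S| <o natLeq"
    using assms(2) by (simp add: finite_iff_ordLess_natLeq)
  moreover have "natLeq \<le>o |UNIV :: 'u set|"
    using assms(1) infinite_iff_natLeq_ordLeq by blast
  ultimately show ?thesis
    unfolding small_def by (rule ordLess_ordLeq_trans)
qed

text \<open>
  The shape \<open>a \<rightarrow> c \<leftarrow> b\<close> of a cospan, with arrows \<open>u\<close> and \<open>v\<close>, on arbitrary elements of the universe
  type. An object doubles as its own identity arrow.
\<close>

locale cospan_shape =
  fixes a b c u v :: 'u
  assumes distinct: "distinct [a, b, c, u, v]"
begin

definition shape :: "('u, 'u) cat" where
  "shape =
     \<lparr>Ob = {a, b, c}, Mor = {a, b, c, u, v},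
      Dom = (\<lambda>x. if x = u then a else if x = v then b else x),
      Cod = (\<lambda>x. if x = u \<or> x = v then c else x),
      Id = (\<lambda>x. x),
      Comp = (\<lambda>y x. if x = u \<or> x = v then x else y)\<rparr>"

definition diagram :: "('o, 'm) cat \<Rightarrow> 'm \<Rightarrow> 'm \<Rightarrow> ('u, 'u, 'o, 'm) ftr" where
  "diagram C f g =
     (let X = (\<lambda>i. if i = a then Dom C f else if i = b then Dom C g else Cod C f)
      in \<lparr>FO = X, FM = (\<lambda>x. if x = u then f else if x = v then g else Id C (X x))\<rparr>)"

definition legs :: "('o, 'm) cat \<Rightarrow> 'm \<Rightarrow> 'm \<Rightarrow> 'm \<Rightarrow> 'u \<Rightarrow> 'm" where
  "legs C f p q = (\<lambda>i. if i = a then p else if i = b then q else f \<cdot>\<^bsub>C\<^esub> p)"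

lemma neqs [simp]:
  "a \<noteq> b" "a \<noteq> c" "a \<noteq> u" "a \<noteq> v" "b \<noteq> c" "b \<noteq> u" "b \<noteq> v" "c \<noteq> u" "c \<noteq> v" "u \<noteq> v"
  "b \<noteq> a" "c \<noteq> a" "u \<noteq> a" "v \<noteq> a" "c \<noteq> b" "u \<noteq> b" "v \<noteq> b" "u \<noteq> c" "v \<noteq> c" "v \<noteq> u"
  using distinct by auto

lemma hom_shape:
  "x \<in> hom shape i j \<longleftrightarrow>
     (x = i \<and> j = i \<and> i \<in> {a, b, c}) \<or> (x = u \<and> i = a \<and> j = c) \<or> (x = v \<and> i = b \<and> j = c)"
  by (auto simp: hom_def shape_def)

lemma Ob_shape: "Ob shape = {a, b, c}"
  and Mor_shape: "Mor shape = {a, b, c, u, v}"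
  by (simp_all add: shape_def)

lemma category_shape: "category shape"
  unfolding category_def hom_shape by (auto simp: shape_def)

lemma diagram_simps [simp]:
  "FO (diagram C f g) a = Dom C f" "FO (diagram C f g) b = Dom C g" "FO (diagram C f g) c = Cod C f"
  "FM (diagram C f g) u = f" "FM (diagram C f g) v = g"
  "FM (diagram C f g) a = Id C (Dom C f)" "FM (diagram C f g) b = Id C (Dom C g)"
  "FM (diagram C f g) c = Id C (Cod C f)"
  by (simp_all add: diagram_def)

lemma legs_simps [simp]:
  "legs C f p q a = p" "legs C f p q b = q" "legs C f p q c = f \<cdot>\<^bsub>C\<^esub> p"
  by (simp_all add: legs_def)

lemma is_functor_diagram:
  assumes C: "category C" and "f \<in> hom C X Z" "g \<in> hom C Y Z"
  shows "is_functor shape C (diagram C f g)"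
proof -
  have fg: "Dom C f = X" "Cod C f = Z" "Dom C g = Y" "Cod C g = Z"
    using assms by (auto simp: hom_def)
  have ob: "X \<in> Ob C" "Y \<in> Ob C" "Z \<in> Ob C"
    using assms hom_Ob[OF C] by blast+
  note [simp] = fg ob Id_hom[OF C] Comp_Id[OF C Id_hom[OF C]] Comp_Id[OF C assms(2)]
    Comp_Id[OF C assms(3)] assms(2,3)
  show ?thesis
    unfolding is_functor_def hom_shape by (auto simp: shape_def)
qed

lemma is_cone_diagram_iff:
  assumes C: "category C" and f: "f \<in> hom C X Z" and g: "g \<in> hom C Y Z"
  shows "is_cone shape C (diagram C f g) L r \<longleftrightarrow>
    r a \<in> hom C L X \<and> r b \<in> hom C L Y \<and> r c = f \<cdot>\<^bsub>C\<^esub> r a \<and> f \<cdot>\<^bsub>C\<^esub> r a = g \<cdot>\<^bsub>C\<^esub> r b"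
proof -
  have fg: "Dom C f = X" "Cod C f = Z" "Dom C g = Y"
    using f g by (auto simp: hom_def)
  show ?thesis
    unfolding is_cone_def hom_shape Ob_shape
    using Comp_hom[OF C _ f, of "r a" L] Comp_Id(2)[OF C, of _ L] hom_Ob[OF C, of "r a" L X]
    by (auto simp: fg)
qed

lemma cone_map_iff:
  assumes C: "category C" and f: "f \<in> hom C X Z" and g: "g \<in> hom C Y Z"
    and r: "is_cone shape C (diagram C f g) L r" and s: "is_cone shape C (diagram C f g) Q s"
    and h: "h \<in> hom C Q L"
  shows "(\<forall>i \<in> Ob shape. r i \<cdot>\<^bsub>C\<^esub> h = s i) \<longleftrightarrow> r a \<cdot>\<^bsub>C\<^esub> h = s a \<and> r b \<cdot>\<^bsub>C\<^esub> h = s b"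
proof -
  have "r a \<in> hom C L X" "r c = f \<cdot>\<^bsub>C\<^esub> r a" "s c = f \<cdot>\<^bsub>C\<^esub> s a"
    using r s is_cone_diagram_iff[OF C f g] by blast+
  moreover from this(1) have "f \<cdot>\<^bsub>C\<^esub> (r a \<cdot>\<^bsub>C\<^esub> h) = (f \<cdot>\<^bsub>C\<^esub> r a) \<cdot>\<^bsub>C\<^esub> h"
    using Comp_assoc[OF C h _ f] by blast
  ultimately have "r a \<cdot>\<^bsub>C\<^esub> h = s a \<Longrightarrow> r c \<cdot>\<^bsub>C\<^esub> h = s c"
    by argo
  then show ?thesis
    unfolding Ob_shape by blast
qed

lemma is_limit_diagram_iff:
  assumes C: "category C" and f: "f \<in> hom C X Z" and g: "g \<in> hom C Y Z"
  shows "is_limit shape C (diagram C f g) L r \<longleftrightarrow>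
    is_pullback C f g L (r a) (r b) \<and> r c = f \<cdot>\<^bsub>C\<^esub> r a"
    (is "?lim \<longleftrightarrow> ?pb")
proof -
  note cone = is_cone_diagram_iff[OF C f g]
  have fg: "f \<in> Mor C" "g \<in> Mor C" "Dom C f = X" "Cod C f = Z" "Dom C g = Y" "Cod C g = Z"
    using f g by (auto simp: hom_def)
  show ?thesis
  proof
    assume lim: ?lim
    then have r: "is_cone shape C (diagram C f g) L r" by (simp add: is_limit_def)
    have "\<exists>!h. h \<in> hom C Q L \<and> r a \<cdot>\<^bsub>C\<^esub> h = s \<and> r b \<cdot>\<^bsub>C\<^esub> h = t"
      if st: "s \<in> hom C Q X" "t \<in> hom C Q Y" "f \<cdot>\<^bsub>C\<^esub> s = g \<cdot>\<^bsub>C\<^esub> t" for Q s t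
    proof -
      have "is_cone shape C (diagram C f g) Q (legs C f s t)"
        using st by (simp add: cone)
      moreover from this have
          "\<exists>!h. h \<in> hom C Q L \<and> (\<forall>i \<in> Ob shape. r i \<cdot>\<^bsub>C\<^esub> h = legs C f s t i)"
        using lim unfolding is_limit_def by blast
      ultimately show ?thesis
        by (simp only: cone_map_iff[OF C f g r] legs_simps cong: conj_cong)
    qed
    then show ?pb
      using r by (simp add: is_pullback_def fg cone)
  next
    assume pb: ?pb
    then have r: "is_cone shape C (diagram C f g) L r"
      by (simp add: is_pullback_def fg cone)
    have "\<exists>!h. h \<in> hom C Q L \<and> (\<forall>i \<in> Ob shape. r i \<cdot>\<^bsub>C\<^esub> h = s i)"
      if s: "is_cone shape C (diagram C f g) Q s" for Q s
    proof -
      have "\<exists>!h. h \<in> hom C Q L \<and> r a \<cdot>\<^bsub>C\<^esub> h = s a \<and> r b \<cdot>\<^bsub>C\<^esub> h = s b"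
        using is_pullbackD(4)[OF conjunct1[OF pb], of "s a" Q "s b"] s by (simp add: fg cone)
      then show ?thesis
        by (simp only: cone_map_iff[OF C f g r s] cong: conj_cong)
    qed
    then show ?lim
      using r by (simp add: is_limit_def)
  qed
qed

lemma small_diagram_diagram:
  fixes U :: "'u itself"
  assumes "infinite (UNIV :: 'u set)"
    and "category C" "f \<in> hom C X Z" "g \<in> hom C Y Z"
  shows "small_diagram U shape C (diagram C f g)"
  using category_shape is_functor_diagram[OF assms(2-)]
  by (simp add: small_diagram_def finite_small[OF assms(1)] Ob_shape Mor_shape)

end

lemma cospan_shape_exists:
  assumes "infinite (UNIV :: 'u set)"
  obtains a b c u v :: 'u where "cospan_shape a b c u v"
proof -
  obtain e :: "nat \<Rightarrow> 'u" where "inj e"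
    using assms by (auto simp: infinite_iff_countable_subset)
  then have "cospan_shape (e 0) (e 1) (e 2) (e 3) (e 4)"
    by (simp add: cospan_shape_def inj_eq)
  then show ?thesis by (rule that)
qed

lemma complete_has_pullbacks:
  fixes U :: "'u itself"
  assumes inf: "infinite (UNIV :: 'u set)" and C: "category C" and "complete U C"
    and fg: "f \<in> hom C X Z" "g \<in> hom C Y Z"
  shows "\<exists>P p q. is_pullback C f g P p q"
proof -
  obtain a b c u v :: 'u where "cospan_shape a b c u v"
    using cospan_shape_exists[OF inf] .
  then interpret cospan_shape a b c u v .
  obtain L r where L: "is_limit shape C (diagram C f g) L r"
    using completeD[OF assms(3) small_diagram_diagram[OF inf C fg]] by blast
  then show ?thesis
    using iffD1[OF is_limit_diagram_iff[OF C fg] L] by blast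
qed


section \<open>Preservation of pullbacks\<close>

lemma preserves_small_limitsD:
  "preserves_small_limits U C D G \<Longrightarrow> small_diagram U J C X \<Longrightarrow> is_limit J C X L p \<Longrightarrow>
     is_limit J D (ftr_comp G X) (FO G L) (FM G \<circ> p)"
  by (simp add: preserves_small_limits_def)

context
  fixes U :: "'u itself" and C :: "('o, 'm) cat" and D :: "('p, 'n) cat"
    and G :: "('o, 'm, 'p, 'n) ftr"
  assumes inf: "infinite (UNIV :: 'u set)" and C: "category C" and D: "category D"
    and lim: "preserves_small_limits U C D G"
begin

text \<open>
  The identity and \<open>f\<close> exhibit \<open>X\<close> as the pullback of \<open>Id C Z\<close> along \<open>f\<close>. As \<open>FM G f\<close> is a leg of the
  image of this limit cone, it starts at the vertex \<open>FO G X\<close> and ends at a value \<open>FO G Z\<close> of the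
  image diagram.
\<close>

lemma preserves_limits_hom:
  assumes f: "f \<in> hom C X Z"
  shows "FM G f \<in> hom D (FO G X) (FO G Z)"
proof -
  obtain a b c u v :: 'u where "cospan_shape a b c u v"
    using cospan_shape_exists[OF inf] .
  then interpret cospan_shape a b c u v .
  have Z: "Id C Z \<in> hom C Z Z"
    using Id_hom[OF C] hom_Ob[OF C f] by blast
  have "is_limit shape C (diagram C f (Id C Z)) X (legs C f (Id C X) f)"
    using is_pullback_Id[OF C f] by (simp add: is_limit_diagram_iff[OF C f Z])
  then have "is_limit shape D (ftr_comp G (diagram C f (Id C Z))) (FO G X)
      (FM G \<circ> legs C f (Id C X) f)"
    by (rule preserves_small_limitsD[OF lim small_diagram_diagram[OF inf C f Z]])
  then have "(FM G \<circ> legs C f (Id C X) f) b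
      \<in> hom D (FO G X) (FO (ftr_comp G (diagram C f (Id C Z))) b)"
    unfolding is_limit_def is_cone_def Ob_shape by blast
  moreover have "Dom C (Id C Z) = Z" using Z by (simp add: hom_def)
  ultimately show ?thesis
    by (simp add: ftr_comp_def)
qed

text \<open>
  The image \<open>e\<close> of \<open>Id C X\<close> is every leg of a limit cone on a diagram whose arrows all equal \<open>e\<close>. Thus
  \<open>e\<close> is idempotent, and both \<open>e\<close> and the identity are maps from this cone to itself.
\<close>

lemma preserves_limits_Id:
  assumes X: "X \<in> Ob C"
  shows "FM G (Id C X) = Id D (FO G X)"
proof -
  obtain a b c u v :: 'u where "cospan_shape a b c u v"
    using cospan_shape_exists[OF inf] .
  then interpret cospan_shape a b c u v .
  let ?i = "Id C X" and ?e = "FM G (Id C X)"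
  let ?D = "ftr_comp G (diagram C ?i ?i)" and ?r = "FM G \<circ> legs C ?i ?i ?i"
  have i: "?i \<in> hom C X X" using Id_hom[OF C X] .
  have e: "?e \<in> hom D (FO G X) (FO G X)" using preserves_limits_hom[OF i] .
  have "is_limit shape C (diagram C ?i ?i) X (legs C ?i ?i ?i)"
    using is_pullback_Id[OF C i] by (simp add: is_limit_diagram_iff[OF C i i])
  then have L: "is_limit shape D ?D (FO G X) ?r"
    by (rule preserves_small_limitsD[OF lim small_diagram_diagram[OF inf C i i]])
  then have cone: "is_cone shape D ?D (FO G X) ?r"
    by (simp add: is_limit_def)
  have r: "?r j = ?e" if "j \<in> Ob shape" for j
    using that Comp_Id(1)[OF C i] by (auto simp: Ob_shape)
  have "FM ?D u \<cdot>\<^bsub>D\<^esub> ?r a = ?r c"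
    using cone unfolding is_cone_def hom_shape by blast
  then have idem: "?e \<cdot>\<^bsub>D\<^esub> ?e = ?e"
    using Comp_Id(1)[OF C i] by (simp add: ftr_comp_def)
  have "\<exists>!h. h \<in> hom D (FO G X) (FO G X) \<and> (\<forall>j \<in> Ob shape. ?r j \<cdot>\<^bsub>D\<^esub> h = ?r j)"
    using L cone unfolding is_limit_def by blast
  moreover have "\<forall>j \<in> Ob shape. ?r j \<cdot>\<^bsub>D\<^esub> ?e = ?r j"
    using r idem by metis
  moreover have "\<forall>j \<in> Ob shape. ?r j \<cdot>\<^bsub>D\<^esub> Id D (FO G X) = ?r j"
    using r Comp_Id(1)[OF D e] by metis
  moreover have "Id D (FO G X) \<in> hom D (FO G X) (FO G X)"
    using Id_hom[OF D] hom_Ob[OF D e] by blast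
  ultimately show ?thesis
    using e by blast
qed

lemma preserves_limits_pullback:
  assumes f: "f \<in> hom C X Z" and g: "g \<in> hom C Y Z" and P: "is_pullback C f g P p q"
  shows "is_pullback D (FM G f) (FM G g) (FO G P) (FM G p) (FM G q)"
proof -
  obtain a b c u v :: 'u where "cospan_shape a b c u v"
    using cospan_shape_exists[OF inf] .
  then interpret cospan_shape a b c u v .
  note Gf = preserves_limits_hom[OF f] and Gg = preserves_limits_hom[OF g]
  have fg: "Dom C f = X" "Cod C f = Z" "Dom C g = Y"
    "Dom D (FM G f) = FO G X" "Cod D (FM G f) = FO G Z" "Dom D (FM G g) = FO G Y"
    using f g Gf Gg by (auto simp: hom_def)
  have ob: "X \<in> Ob C" "Y \<in> Ob C" "Z \<in> Ob C"
    using f g hom_Ob[OF C] by blast+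
  \<comment> \<open>An equality of records, not only of values on the shape: outside it, \<open>diagram\<close> takes the value
      at \<open>c\<close> and its identity, which \<open>G\<close> respects as well.\<close>
  have diag: "ftr_comp G (diagram C f g) = diagram D (FM G f) (FM G g)"
    using ob by (auto simp: ftr_comp_def diagram_def Let_def fg preserves_limits_Id fun_eq_iff)
  have "is_limit shape C (diagram C f g) P (legs C f p q)"
    using P by (simp add: is_limit_diagram_iff[OF C f g])
  then have "is_limit shape D (ftr_comp G (diagram C f g)) (FO G P) (FM G \<circ> legs C f p q)"
    by (rule preserves_small_limitsD[OF lim small_diagram_diagram[OF inf C f g]])
  then show ?thesis
    by (simp add: diag is_limit_diagram_iff[OF D Gf Gg])
qed

end


section \<open>Homotopy fiber products\<close>

text \<open>The chosen vertex is a pullback as soon as some pullback exists.\<close>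

lemma homotopy_fiber_product_is_pullback:
  assumes "is_pullback C (rgt F f) (rgt F g) P p q"
  shows "\<exists>p q. is_pullback C (rgt F f) (rgt F g) (homotopy_fiber_product C F f g) p q"
  unfolding homotopy_fiber_product_def by (rule someI_ex) (use assms in blast)

text \<open>
  The pullback of \<open>rgt F f\<close> and \<open>rgt F g\<close> is mapped to a pullback of their images. Strict compatibility
  with the factorizations says that these images are the very fibrations whose pullback is the
  homotopy fiber product in \<open>D\<close>.
\<close>

lemma preserves_homotopy_fiber_product:
  fixes U :: "'u itself"
  assumes inf: "infinite (UNIV :: 'u set)" and C: "category C" "complete U C" and D: "category D"
    and F: "functorial_factorization C L R F"
    and lim: "preserves_small_limits U C D G"
    and rgt: "\<And>k. k \<in> Mor C \<Longrightarrow> rgt F' (FM G k) = FM G (rgt F k)"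
    and f: "f \<in> hom C X Z" and g: "g \<in> hom C Y Z"
  shows "isomorphic D (FO G (homotopy_fiber_product C F f g))
    (homotopy_fiber_product D F' (FM G f) (FM G g))"
proof -
  have r: "rgt F f \<in> hom C (mid F f) Z" "rgt F g \<in> hom C (mid F g) Z"
    using F f g unfolding functorial_factorization_def by blast+
  obtain P p q where P: "is_pullback C (rgt F f) (rgt F g) P p q"
    using complete_has_pullbacks[OF inf C r] by blast
  obtain p q where
      "is_pullback C (rgt F f) (rgt F g) (homotopy_fiber_product C F f g) p q"
    using homotopy_fiber_product_is_pullback[OF P] by blast
  then have "is_pullback D (FM G (rgt F f)) (FM G (rgt F g))
      (FO G (homotopy_fiber_product C F f g)) (FM G p) (FM G q)"
    by (rule preserves_limits_pullback[OF inf C(1) D lim r])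
  moreover have "f \<in> Mor C" "g \<in> Mor C"
    using f g by (auto simp: hom_def)
  ultimately have image: "is_pullback D (rgt F' (FM G f)) (rgt F' (FM G g))
      (FO G (homotopy_fiber_product C F f g)) (FM G p) (FM G q)"
    by (simp add: rgt)
  obtain p' q' where "is_pullback D (rgt F' (FM G f)) (rgt F' (FM G g))
      (homotopy_fiber_product D F' (FM G f) (FM G g)) p' q'"
    using homotopy_fiber_product_is_pullback[OF image] by blast
  then show ?thesis
    by (rule is_pullback_unique[OF D image])
qed

theorem proposition2p2p3p1:
  fixes U :: "'u itself"
    and C :: "('o, 'm) cat" and T :: "('o, 'm) tensor" and M :: "'m model"
    and Cov :: "('o, 'm) aff_obj \<Rightarrow> (('o, 'm) aff_obj, ('o, 'm) aff_mor) ho_mor set set"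
    and F :: "(('o, 'm) aff_obj, ('o, 'm) aff_mor) factorization"
    and C\<^sub>E :: "('p, 'n) cat" and T\<^sub>E :: "('p, 'n) tensor" and M\<^sub>E :: "'n model"
    and Cov\<^sub>E :: "('p, 'n) aff_obj \<Rightarrow> (('p, 'n) aff_obj, ('p, 'n) aff_mor) ho_mor set set"
    and F\<^sub>E :: "(('p, 'n) aff_obj, ('p, 'n) aff_mor) factorization"
    and E :: "('o, 'm, 'p, 'n) mon_ftr"
    and X Y Z :: "('o, 'm) aff_obj" and f g :: "('o, 'm) aff_mor"
  assumes "universe U"
    and "HA_context U C T M"
    and "model_category U (Comm C T) (lifted_model (Comm C T) M)"
    and "functorial_factorization (Aff C T)
           (WE (Aff_model C T M) \<inter> Cof (Aff_model C T M)) (Fib (Aff_model C T M)) F"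
    and "model_topology (Aff C T) (WE (Aff_model C T M)) F Cov"
    and "energy_functor U C T M Cov F C\<^sub>E T\<^sub>E M\<^sub>E Cov\<^sub>E F\<^sub>E E"
    and "f \<in> hom (Aff C T) X Z" and "g \<in> hom (Aff C T) Y Z"
  shows "isomorphic (Aff C\<^sub>E T\<^sub>E)
           (FO (Aff_functor C\<^sub>E E) (homotopy_fiber_product (Aff C T) F f g))
           (homotopy_fiber_product (Aff C\<^sub>E T\<^sub>E) F\<^sub>E
              (FM (Aff_functor C\<^sub>E E) f) (FM (Aff_functor C\<^sub>E E) g))"
proof -
  have "category (Comm C T)" "cocomplete U (Comm C T)"
    using assms(3) by (simp_all add: model_category_def)
  then have A: "category (Aff C T)" "complete U (Aff C T)"
    by (simp_all add: Aff_def category_op complete_op)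
  have "category (Comm C\<^sub>E T\<^sub>E)"
    and lim: "preserves_small_limits U (Aff C T) (Aff C\<^sub>E T\<^sub>E) (Aff_functor C\<^sub>E E)"
    and rgt: "\<And>k. k \<in> Mor (Aff C T) \<Longrightarrow>
      rgt F\<^sub>E (FM (Aff_functor C\<^sub>E E) k) = FM (Aff_functor C\<^sub>E E) (rgt F k)"
    using assms(6) by (simp_all add: energy_functor_def Let_def model_category_def)
  then have A': "category (Aff C\<^sub>E T\<^sub>E)"
    by (simp add: Aff_def category_op)
  show ?thesis
    using preserves_homotopy_fiber_product[OF universe_infinite[OF assms(1)] A A' assms(4) lim rgt
        assms(7,8)] .
qed

end
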